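(* Given a scalar $\rho$, assume that there exist matrices $P \in \mathbb{S}_{3n}^{+}$, $W_1, W_2, Z_1, Z_2 \in \mathbb{S}_{n}^{+}$, $R \in \mathbb{S}_{m}^{+}$, a symmetric matrix $Q \in \mathbb{R}^{p \times p}$, and matrices $S \in \mathbb{R}^{p \times m}$ and $X \in \mathbb{R}^{2n\times 2n}$ such that \begin{equation*} \Psi_z \succ 0, \qquad \Gamma^{\perp\top}\left(\bar{\Phi}(d)+\Upsilon \right) \Gamma^{\perp} \prec 0, \end{equation*} \begin{equation*} \begin{bmatrix} Q + \rho \mathbf{1}_{p \times m} S^\top + S \rho \mathbf{1}_{m \times p} & \star \\ R^\top \rho \mathbf{1}_{m \times p} & -R \end{bmatrix} \prec 0, \end{equation*} hold for $d=d_m$ and $d=d_M$, where \begin{equation*} \Gamma^{\perp} = \begin{bmatrix} \begin{bmatrix} A & 0_{n \times 6n} & B \end{bmatrix} \\ I_{7n+m} \end{bmatrix} \in \mathbb{R}^{(8n+m)\times(7n+m)} \end{equation*} (the block row $[A~~0_{n\times 6n}~~B]$ stacked on top of the identity $I_{7n+m}$), \begin{equation*} \begin{split} &\Upsilon = \Upsilon_1 + \Upsilon_2 + \Upsilon_2^{\top}, \\ &\Upsilon_1 = \mathrm{diag}(0_{3n \times 3n},-C^{\top} Q C,0_{4n \times 4n},-R), \\ &\Upsilon_2 = \begin{bmatrix} 0_{n \times 3n} & I & 0_{n \times (4n+m)} \end{bmatrix}^{\top} \begin{bmatrix} 0_{n \times 8n} & -C^{\top} S \end{bmatrix}, \end{split}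 \end{equation*} and \begin{equation*} \begin{split} \bar{\Phi}(d)&=\mathrm{diag}\{\Phi(d),0_{m \times m}\}, \\ \Phi(d) &= F_{2}^{\top}PF_{2} -F_{1}^{\top}PF_{1} + \mathrm{He}\{F^{\top}(d)P(F_2-F_1)\}+W \\ &\quad +F_3^{\top}(d_m^2 Z_1+d_{\Delta}^2 Z_2) F_3-F_{s}^{\top} \mathscr{Z}_1(d_m)F_{s}-F_{\Psi}^{\top}\Psi_zF_{\Psi}, \end{split} \end{equation*} with $\mathrm{He}\{Y\}=Y+Y^{\top}$, $d_\Delta = d_M-d_m$, \begin{equation*} W = \mathrm{diag}(0,W_1,W_2-W_1,0,-W_2,0,0,0), \end{equation*} \begin{equation*} \mathscr{Z}_1(d_m) = \mathrm{diag}\left(Z_1,3\gamma(d_m)Z_1\right), \quad \mathscr{Z}_2 = \mathrm{diag}\left(Z_2,3Z_2\right), \end{equation*} where $\gamma(d)=1$ if $d=1$ and $\gamma(d)=(d+1)/(d-1)$ if $d>1$, \begin{equation*} M = \begin{bmatrix} 0 & I & -I & 0 & 0 & 0 \\ 0 & I & I & 0 & 0 & -2I \end{bmatrix}\in\mathbb{R}^{2n\times 6n}, \end{equation*} \begin{equation*} F_{\Psi} = \begin{bmatrix} \begin{bmatrix} 0_{2n\times2n} & M \end{bmatrix} \\ \begin{bmatrix} 0_{2n\times n} & M & 0_{2n\times n} \end{bmatrix} \end{bmatrix}\in\mathbb{R}^{4n\times 8n}, \end{equation*} \begin{equation*} F_{s} = \begin{bmatrix} M & 0_{2n\times2n} \end{bmatrix},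 \quad F_{3} = \begin{bmatrix} I & -I & 0 & 0 & 0 & 0 & 0 & 0 \end{bmatrix}, \end{equation*} \begin{equation*} F_{1} = \begin{bmatrix} 0 & I & 0 & 0 & 0 & 0 & 0 & 0 \\ 0 & -I & 0 & 0 & 0 & (d_m +1)I & 0 & 0 \\ 0 & 0 & -I & -I & 0 & 0& (1-d_m)I & (d_M+1)I \end{bmatrix}, \end{equation*} \begin{equation*} F_{2} = \begin{bmatrix} I & 0 & 0 & 0 & 0 & 0 & 0 & 0 \\ 0 & 0 & -I & 0 & 0 & (d_m +1)I & 0 & 0 \\ 0 & 0 & 0 & -I & -I & 0& (1-d_m)I & (d_M+1)I \end{bmatrix}, \end{equation*} \begin{equation*} F(d) = \begin{bmatrix} 0_{2n \times 6n} & 0_{2n \times n} & 0_{2n \times n} \\ 0_{n \times 6n} & d I_n & -d I_n \end{bmatrix}, \quad \Psi_z = \begin{bmatrix} \mathscr{Z}_2 & X \\ \star & \mathscr{Z}_2 \end{bmatrix}. \end{equation*} Then the SOF gain $K=-R^{-1}S^{\top}$ asymptotically stabilizes the closed-loop system $x(k+1)=Ax(k)+BKCx(k-d(k))$ for any time-varying delay $d_m \leq d(k) \leq d_M$.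
   Context: Consider the discrete-time plant $x(k+1)=Ax(k)+Bu(k-d(k))$, $y(k)=Cx(k)$, $u(k)=\theta_u(k)$ for $k\in[-d_M,-1]$, with $x(k)\in\mathbb{R}^n$, $y(k)\in\mathbb{R}^p$, $u(k)\in\mathbb{R}^m$, constant known matrices $A,B,C$ with $(A,B)$ controllable, and a bounded time-varying delay $d(k)$ satisfying $1\le d_m\le d(k)\le d_M$ with known integers $d_m,d_M$ (the value of $d(k)$ itself is unknown and may vary arbitrarily in this range). The static output feedback law $u(k)=Ky(k)$, $K\in\mathbb{R}^{m\times p}$, gives the closed loop $x(k+1)=Ax(k)+BKCx(k-d(k))$, $x(k)=\phi(k)$ for $k\in[-d_M,0]$. Notation: $\mathbb{S}_n^{+}$ is the set of $n\times n$ symmetric positive definite matrices; $\succ 0$ / $\prec 0$ denote positive / negative definiteness; $\mathbf{1}$ is an all-ones matrix; $\star$ denotes symmetric blocks; unsubscripted $I$ and $0$ blocks in $F_1,F_2,F_3,M,W$ are $n\times n$. *)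

theory Defs
  imports "Jordan_Normal_Form.Gauss_Jordan_Elimination" "Jordan_Normal_Form.DL_Rank"
begin

definition hcat :: "real mat \<Rightarrow> real mat \<Rightarrow> real mat" where
  "hcat A B = mat (dim_row A) (dim_col A + dim_col B)
     (\<lambda>(i,j). if j < dim_col A then A $$ (i,j) else B $$ (i, j - dim_col A))"

definition vcat :: "real mat \<Rightarrow> real mat \<Rightarrow> real mat" where
  "vcat A B = mat (dim_row A + dim_row B) (dim_col A)
     (\<lambda>(i,j). if i < dim_row A then A $$ (i,j) else B $$ (i - dim_row A, j))"

fun hcats :: "real mat list \<Rightarrow> real mat" where
  "hcats [] = 0\<^sub>m 0 0"
| "hcats [A] = A"
| "hcats (A # As) = hcat A (hcats As)"

fun vcats :: "real mat list \<Rightarrow> real mat" where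
  "vcats [] = 0\<^sub>m 0 0"
| "vcats [A] = A"
| "vcats (A # As) = vcat A (vcats As)"

definition blocks :: "real mat list list \<Rightarrow> real mat" where
  "blocks rs = vcats (map hcats rs)"

fun bdiag :: "real mat list \<Rightarrow> real mat" where
  "bdiag [] = 0\<^sub>m 0 0"
| "bdiag [A] = A"
| "bdiag (A # As) = (let D = bdiag As in
     four_block_mat A (0\<^sub>m (dim_row A) (dim_col D)) (0\<^sub>m (dim_row D) (dim_col A)) D)"

definition ones :: "nat \<Rightarrow> nat \<Rightarrow> real mat" where
  "ones r c = mat r c (\<lambda>_. 1)"

definition He :: "real mat \<Rightarrow> real mat" where
  "He Y = Y + Y\<^sup>T"

definition sym_mat :: "nat \<Rightarrow> real mat \<Rightarrow> bool" where
  "sym_mat k M \<longleftrightarrow> M \<in> carrier_mat k k \<and> M\<^sup>T = M"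

definition posdef :: "nat \<Rightarrow> real mat \<Rightarrow> bool" where
  "posdef k M \<longleftrightarrow> sym_mat k M \<and>
     (\<forall>x \<in> carrier_vec k. x \<noteq> 0\<^sub>v k \<longrightarrow> x \<bullet> (M *\<^sub>v x) > 0)"

definition negdef :: "nat \<Rightarrow> real mat \<Rightarrow> bool" where
  "negdef k M \<longleftrightarrow> posdef k (- M)"

definition ctrb_mat :: "nat \<Rightarrow> real mat \<Rightarrow> real mat \<Rightarrow> real mat" where
  "ctrb_mat n A B = hcats (map (\<lambda>k. (A ^\<^sub>m k) * B) [0..<n])"

definition controllable :: "nat \<Rightarrow> real mat \<Rightarrow> real mat \<Rightarrow> bool" where
  "controllable n A B \<longleftrightarrow> vec_space.rank n (ctrb_mat n A B) = n"

definition gamma :: "nat \<Rightarrow> real" where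
  "gamma d = (if d = 1 then 1 else (real d + 1) / (real d - 1))"

definition vnorm :: "real vec \<Rightarrow> real" where
  "vnorm v = sqrt (\<Sum>i<dim_vec v. (v $ i)^2)"

definition closed_loop_solution ::
  "nat \<Rightarrow> real mat \<Rightarrow> real mat \<Rightarrow> nat \<Rightarrow> (nat \<Rightarrow> nat) \<Rightarrow> (int \<Rightarrow> real vec)
     \<Rightarrow> (int \<Rightarrow> real vec) \<Rightarrow> bool" where
  "closed_loop_solution n A Ad dM d phi x \<longleftrightarrow>
     (\<forall>k. - int dM \<le> k \<and> k \<le> 0 \<longrightarrow> x k = phi k) \<and>
     (\<forall>k::nat. x (int k + 1) = A *\<^sub>v x (int k) + Ad *\<^sub>v x (int k - int (d k)))"

definition asymp_stable_delay ::
  "nat \<Rightarrow> real mat \<Rightarrow> real mat \<Rightarrow> nat \<Rightarrow> nat \<Rightarrow> bool" where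
  "asymp_stable_delay n A Ad dm dM \<longleftrightarrow>
     (\<forall>d::nat \<Rightarrow> nat. (\<forall>k. dm \<le> d k \<and> d k \<le> dM) \<longrightarrow>
        (\<forall>\<epsilon>>0. \<exists>\<delta>>0. \<forall>phi x.
            (\<forall>k. phi k \<in> carrier_vec n) \<longrightarrow> closed_loop_solution n A Ad dM d phi x \<longrightarrow>
            (\<forall>k. - int dM \<le> k \<and> k \<le> 0 \<longrightarrow> vnorm (phi k) < \<delta>) \<longrightarrow>
            (\<forall>k::nat. vnorm (x (int k)) < \<epsilon>))
      \<and> (\<forall>phi x. (\<forall>k. phi k \<in> carrier_vec n) \<longrightarrow> closed_loop_solution n A Ad dM d phi x \<longrightarrow>
            (\<lambda>k::nat. vnorm (x (int k))) \<longlonglongrightarrow> 0))"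


abbreviation Iblk :: "nat \<Rightarrow> real mat" where "Iblk n \<equiv> 1\<^sub>m n"
abbreviation Oblk :: "nat \<Rightarrow> real mat" where "Oblk n \<equiv> 0\<^sub>m n n"

definition M_mat :: "nat \<Rightarrow> real mat" where
  "M_mat n = blocks
     [[Oblk n, Iblk n, - Iblk n, Oblk n, Oblk n, Oblk n],
      [Oblk n, Iblk n, Iblk n, Oblk n, Oblk n, (-2) \<cdot>\<^sub>m Iblk n]]"

definition F_Psi :: "nat \<Rightarrow> real mat" where
  "F_Psi n = blocks
     [[0\<^sub>m (2*n) (2*n), M_mat n],
      [0\<^sub>m (2*n) n, M_mat n, 0\<^sub>m (2*n) n]]"

definition F_s :: "nat \<Rightarrow> real mat" where
  "F_s n = blocks [[M_mat n, 0\<^sub>m (2*n) (2*n)]]"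

definition F_3 :: "nat \<Rightarrow> real mat" where
  "F_3 n = blocks [[Iblk n, - Iblk n, Oblk n, Oblk n, Oblk n, Oblk n, Oblk n, Oblk n]]"

definition F_1 :: "nat \<Rightarrow> nat \<Rightarrow> nat \<Rightarrow> real mat" where
  "F_1 n dm dM = blocks
     [[Oblk n, Iblk n, Oblk n, Oblk n, Oblk n, Oblk n, Oblk n, Oblk n],
      [Oblk n, - Iblk n, Oblk n, Oblk n, Oblk n, (real dm + 1) \<cdot>\<^sub>m Iblk n, Oblk n, Oblk n],
      [Oblk n, Oblk n, - Iblk n, - Iblk n, Oblk n, Oblk n,
         (1 - real dm) \<cdot>\<^sub>m Iblk n, (real dM + 1) \<cdot>\<^sub>m Iblk n]]"

definition F_2 :: "nat \<Rightarrow> nat \<Rightarrow> nat \<Rightarrow> real mat" where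
  "F_2 n dm dM = blocks
     [[Iblk n, Oblk n, Oblk n, Oblk n, Oblk n, Oblk n, Oblk n, Oblk n],
      [Oblk n, Oblk n, - Iblk n, Oblk n, Oblk n, (real dm + 1) \<cdot>\<^sub>m Iblk n, Oblk n, Oblk n],
      [Oblk n, Oblk n, Oblk n, - Iblk n, - Iblk n, Oblk n,
         (1 - real dm) \<cdot>\<^sub>m Iblk n, (real dM + 1) \<cdot>\<^sub>m Iblk n]]"

definition F_d :: "nat \<Rightarrow> real \<Rightarrow> real mat" where
  "F_d n d = blocks
     [[0\<^sub>m (2*n) (6*n), 0\<^sub>m (2*n) n, 0\<^sub>m (2*n) n],
      [0\<^sub>m n (6*n), d \<cdot>\<^sub>m Iblk n, (- d) \<cdot>\<^sub>m Iblk n]]"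

definition W_mat :: "nat \<Rightarrow> real mat \<Rightarrow> real mat \<Rightarrow> real mat" where
  "W_mat n W1 W2 = bdiag [Oblk n, W1, W2 - W1, Oblk n, - W2, Oblk n, Oblk n, Oblk n]"

definition Zs1 :: "nat \<Rightarrow> real mat \<Rightarrow> real mat" where
  "Zs1 dm Z1 = bdiag [Z1, (3 * gamma dm) \<cdot>\<^sub>m Z1]"

definition Zs2 :: "real mat \<Rightarrow> real mat" where
  "Zs2 Z2 = bdiag [Z2, 3 \<cdot>\<^sub>m Z2]"

definition Psi_z :: "real mat \<Rightarrow> real mat \<Rightarrow> real mat" where
  "Psi_z Z2 X = blocks [[Zs2 Z2, X], [X\<^sup>T, Zs2 Z2]]"

definition Phi :: "nat \<Rightarrow> nat \<Rightarrow> nat \<Rightarrow> real mat \<Rightarrow> real mat \<Rightarrow> real mat \<Rightarrow> real mat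
    \<Rightarrow> real mat \<Rightarrow> real mat \<Rightarrow> real \<Rightarrow> real mat" where
  "Phi n dm dM P W1 W2 Z1 Z2 X d =
     (F_2 n dm dM)\<^sup>T * P * F_2 n dm dM - (F_1 n dm dM)\<^sup>T * P * F_1 n dm dM
     + He ((F_d n d)\<^sup>T * P * (F_2 n dm dM - F_1 n dm dM)) + W_mat n W1 W2
     + (F_3 n)\<^sup>T * ((real dm)^2 \<cdot>\<^sub>m Z1 + (real dM - real dm)^2 \<cdot>\<^sub>m Z2) * F_3 n
     - (F_s n)\<^sup>T * Zs1 dm Z1 * F_s n
     - (F_Psi n)\<^sup>T * Psi_z Z2 X * F_Psi n"

definition Phi_bar :: "nat \<Rightarrow> nat \<Rightarrow> nat \<Rightarrow> nat \<Rightarrow> real mat \<Rightarrow> real mat \<Rightarrow> real mat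
    \<Rightarrow> real mat \<Rightarrow> real mat \<Rightarrow> real mat \<Rightarrow> real \<Rightarrow> real mat" where
  "Phi_bar n m dm dM P W1 W2 Z1 Z2 X d = bdiag [Phi n dm dM P W1 W2 Z1 Z2 X d, 0\<^sub>m m m]"

definition Gamma_perp :: "nat \<Rightarrow> nat \<Rightarrow> real mat \<Rightarrow> real mat \<Rightarrow> real mat" where
  "Gamma_perp n m A B = vcat (hcats [A, 0\<^sub>m n (6*n), B]) (1\<^sub>m (7*n + m))"

definition Upsilon :: "nat \<Rightarrow> nat \<Rightarrow> real mat \<Rightarrow> real mat \<Rightarrow> real mat \<Rightarrow> real mat \<Rightarrow> real mat" where
  "Upsilon n m C Q R S =
     (let U1 = bdiag [0\<^sub>m (3*n) (3*n), - (C\<^sup>T * Q * C), 0\<^sub>m (4*n) (4*n), - R];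
          U2 = (hcats [0\<^sub>m n (3*n), Iblk n, 0\<^sub>m n (4*n + m)])\<^sup>T
               * hcats [0\<^sub>m n (8*n), - (C\<^sup>T * S)]
      in U1 + U2 + U2\<^sup>T)"

definition LMI3 :: "nat \<Rightarrow> nat \<Rightarrow> real \<Rightarrow> real mat \<Rightarrow> real mat \<Rightarrow> real mat \<Rightarrow> real mat" where
  "LMI3 p m \<rho> Q R S =
     (let L = R\<^sup>T * (\<rho> \<cdot>\<^sub>m ones m p)
      in blocks [[Q + (\<rho> \<cdot>\<^sub>m ones p m) * S\<^sup>T + S * (\<rho> \<cdot>\<^sub>m ones m p), L\<^sup>T], [L, - R]])"

end

theory Submission
  imports Defs "HOL-Analysis.Function_Topology"
begin

text \<open>
  Along a closed-loop trajectory a Lyapunov--Krasovskii functional decreases by a uniform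
  multiple of \<open>|x(k)|\<^sup>2\<close>. Its increment equals a quadratic form in the stacked vector of
  \<open>x(k+1), x(k), x(k-d\<^sub>m), x(k-d), x(k-d\<^sub>M)\<close> and the three window means, minus weighted sums of
  squared increments of \<open>x\<close>. The discrete Wirtinger inequality on the windows
  \<open>[0,d\<^sub>m]\<close>, \<open>[d\<^sub>m,d]\<close>, \<open>[d,d\<^sub>M]\<close> and a reciprocally convex combination of the last two bound
  these sums, and the increment is at most the form of \<open>\<Phi>(d)\<close>. That form is affine in \<open>d\<close>, so
  its sign is decided at \<open>d\<^sub>m\<close> and \<open>d\<^sub>M\<close>. There, \<open>\<Gamma>\<^sup>\<bottom>\<close> encodes the dynamics, and the form of
  \<open>\<Upsilon>\<close> at \<open>u = K y\<close> is nonnegative: with \<open>L = \<rho>\<one>\<close>, the third inequality tested on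
  \<open>(y, L y)\<close> gives \<open>y\<^sup>T Q y \<le> u\<^sup>T R u - (L y - u)\<^sup>T R (L y - u)\<close>.
\<close>

section \<open>Quadratic forms and coercivity\<close>

definition qform :: "real mat \<Rightarrow> real vec \<Rightarrow> real" where
  "qform M v = v \<bullet> (M *\<^sub>v v)"

text \<open>As a polynomial in the values of \<open>f\<close>, a form is visibly continuous, and
  identities and bounds for single products \<open>f i * f j\<close> carry over to it.\<close>

lemma qform_vec:
  assumes "M \<in> carrier_mat n n"
  shows "qform M (vec n f) = (\<Sum>i<n. \<Sum>j<n. M $$ (i,j) * (f i * f j))"
  using assms unfolding qform_def scalar_prod_def mult_mat_vec_def row_def
  by (auto simp: sum_distrib_left atLeast0LessThan mult_ac intro!: sum.cong)

lemma posdef_carrier: "posdef k M \<Longrightarrow> M \<in> carrier_mat k k"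
  by (simp add: posdef_def sym_mat_def)

lemma posdef_transpose: "posdef k M \<Longrightarrow> M\<^sup>T = M"
  by (simp add: posdef_def sym_mat_def)

lemma posdef_qform_nonneg:
  assumes "posdef k M" "v \<in> carrier_vec k"
  shows "0 \<le> qform M v"
  using assms by (cases "v = 0\<^sub>v k") (auto simp: posdef_def sym_mat_def qform_def less_imp_le)

lemma qform_smult:
  assumes "M \<in> carrier_mat k k" "v \<in> carrier_vec k"
  shows "qform M (c \<cdot>\<^sub>v v) = c\<^sup>2 * qform M v"
  using assms by (simp add: qform_def mult_mat_vec power2_eq_square)

lemma sum_squares_vec: "vec k f \<bullet> vec k f = (\<Sum>i<k. (f i :: real)\<^sup>2)"
  by (simp add: scalar_prod_def atLeast0LessThan power2_eq_square)

text \<open>The sphere is realised in the product space \<open>nat \<Rightarrow> real\<close>: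
  coordinates below \<open>k\<close> range over [-1,1], all others are fixed at 0. The box is
  compact by Tychonoff, the sphere is a closed part of it, and the form is continuous.\<close>

lemma qform_attains_min_on_sphere:
  fixes M :: "real mat"
  assumes M: "M \<in> carrier_mat k k" and k: "k > 0"
  shows "\<exists>f. (\<Sum>i<k. (f i)\<^sup>2) = 1 \<and>
           (\<forall>g. (\<Sum>i<k. (g i)\<^sup>2) = 1 \<longrightarrow> qform M (vec k f) \<le> qform M (vec k g))"
proof -
  let ?K = "PiE UNIV (\<lambda>i::nat. if i < k then {-1..1::real} else {0})"
  let ?S = "?K \<inter> {f. (\<Sum>i<k. (f i)\<^sup>2) = 1}"
  have "compactin (product_topology (\<lambda>i. euclidean) UNIV) ?K"
    by (subst compactin_PiE) auto
  then have cK: "compact ?K"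
    by (simp add: euclidean_product_topology)
  have cont: "continuous_on UNIV (\<lambda>f::nat \<Rightarrow> real. f i)" for i
    by (rule continuous_on_product_coordinates)
  have "closed {f::nat \<Rightarrow> real. (\<Sum>i<k. (f i)\<^sup>2) = 1}"
    by (intro closed_Collect_eq continuous_intros cont)
  then have cS: "compact ?S"
    using cK by (rule compact_Int_closed[rotated])
  \<comment> \<open>The first unit vector witnesses nonemptiness; it exists because
    \<open>k > 0\<close>.\<close>
  have "(\<lambda>i. if i = 0 then 1 else 0) \<in> ?S"
    using k by (auto simp: if_distrib[of "\<lambda>x. x^2"] cong: if_cong)
  then have ne: "?S \<noteq> {}" by blast
  have "continuous_on ?S (\<lambda>f. qform M (vec k f))"
    unfolding qform_vec[OF M]
    by (intro continuous_intros continuous_on_subset[OF cont]) auto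
  from continuous_attains_inf[OF cS ne this] obtain f where
    f: "f \<in> ?S" and min: "\<And>g. g \<in> ?S \<Longrightarrow> qform M (vec k f) \<le> qform M (vec k g)" by blast
  have "qform M (vec k f) \<le> qform M (vec k g)" if g: "(\<Sum>i<k. (g i)\<^sup>2) = 1" for g
  proof -
    \<comment> \<open>Minimality is known only inside the box, so \<open>g\<close> is cut off beyond
      \<open>k\<close>; \<open>vec k\<close> does not see the change.\<close>
    let ?g = "\<lambda>i. if i < k then g i else 0"
    have "(g i)\<^sup>2 \<le> 1" if "i < k" for i
      using member_le_sum[of i "{..<k}" "\<lambda>i. (g i)\<^sup>2"] that g by auto
    then have "\<bar>g i\<bar> \<le> 1" if "i < k" for i
      using that by (simp add: abs_square_le_1)
    then have "?g \<in> ?S" using g by (auto simp: abs_le_iff minus_le_iff)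
    moreover have "vec k ?g = vec k g" by auto
    ultimately show ?thesis using min[of ?g] by simp
  qed
  with f show ?thesis by blast
qed

text \<open>The constant is the minimum of the form on the unit sphere, positive because a minimiser
  is nonzero; homogeneity of degree two extends the bound to all vectors. In dimension 0 there is no
  sphere and any constant serves.\<close>

lemma posdef_coercive:
  assumes "posdef k M"
  obtains e where "e > 0" "\<And>v. v \<in> carrier_vec k \<Longrightarrow> e * (v \<bullet> v) \<le> qform M v"
proof (cases "k = 0")
  case True
  show thesis
    by (rule that[of 1]) (use True in \<open>auto simp: scalar_prod_def qform_def\<close>)
next
  case False
  note M = posdef_carrier[OF assms]
  from qform_attains_min_on_sphere[OF M] False obtain f where
    f: "(\<Sum>i<k. (f i)\<^sup>2) = 1" and
    min: "\<And>g. (\<Sum>i<k. (g i)\<^sup>2) = 1 \<Longrightarrow> qform M (vec k f) \<le> qform M (vec k g)" by auto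
  have "vec k f \<noteq> 0\<^sub>v k"
  proof
    assume "vec k f = 0\<^sub>v k"
    then have "vec k f \<bullet> vec k f = 0" by simp
    with f show False by (simp add: sum_squares_vec)
  qed
  then have pos: "qform M (vec k f) > 0"
    using assms by (auto simp: posdef_def qform_def)
  show thesis
  proof (rule that[OF pos])
    fix v :: "real vec"
    assume v: "v \<in> carrier_vec k"
    then have vv: "v = vec k (\<lambda>i. v $ i)" by auto
    have vs: "v \<bullet> v = (\<Sum>i<k. (v $ i)\<^sup>2)" by (subst vv, subst (2) vv, simp only: sum_squares_vec)
    show "qform M (vec k f) * (v \<bullet> v) \<le> qform M v"
    proof (cases "v \<bullet> v = 0")
      case True
      then show ?thesis using posdef_qform_nonneg[OF assms v] by simp
    next
      case False
      then have p: "v \<bullet> v > 0" using vs by (simp add: sum_nonneg less_le)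
      define c where "c = 1 / sqrt (v \<bullet> v)"
      have c2: "c\<^sup>2 * (v \<bullet> v) = 1" using p by (simp add: c_def power_divide)
      have "(\<Sum>i<k. (c * v $ i)\<^sup>2) = 1"
        using c2 by (simp add: power_mult_distrib sum_distrib_left[symmetric] vs)
      from min[OF this] have "qform M (vec k f) \<le> qform M (vec k (\<lambda>i. c * v $ i))" .
      also have "vec k (\<lambda>i. c * v $ i) = c \<cdot>\<^sub>v v" using v by auto
      also have "qform M \<dots> = c\<^sup>2 * qform M v" by (rule qform_smult[OF M v])
      finally have "qform M (vec k f) * (v \<bullet> v) \<le> c\<^sup>2 * qform M v * (v \<bullet> v)"
        using p by simp
      also have "\<dots> = qform M v" using c2 by (simp add: algebra_simps)
      finally show ?thesis .
    qed
  qed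
qed

section \<open>Discrete Wirtinger and reciprocally convex inequalities\<close>

text \<open>Moves the sum over time inside the entries of \<open>M\<close>, so that a scalar
  identity for each pair of coordinates can be applied.\<close>

lemma sum_qform_vec:
  assumes "M \<in> carrier_mat n n"
  shows "(\<Sum>l\<in>L. qform M (vec n (f l))) = (\<Sum>i<n. \<Sum>j<n. M $$ (i,j) * (\<Sum>l\<in>L. f l i * f l j))"
proof -
  have "(\<Sum>l\<in>L. qform M (vec n (f l))) = (\<Sum>i<n. \<Sum>l\<in>L. \<Sum>j<n. M $$ (i,j) * (f l i * f l j))"
    unfolding qform_vec[OF assms] by (rule sum.swap)
  also have "\<dots> = (\<Sum>i<n. \<Sum>j<n. \<Sum>l\<in>L. M $$ (i,j) * (f l i * f l j))"
    by (intro sum.cong refl sum.swap)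
  finally show ?thesis by (simp add: sum_distrib_left)
qed

text \<open>At \<open>c = real h\<close> the sum is 0: the affine weights are then orthogonal to the
  constants.\<close>

lemma sum_affine: "(\<Sum>j<h. 2 * real j + 1 - c) = (real h)\<^sup>2 - c * real h"
  by (induction h) (simp_all add: power2_eq_square algebra_simps)

text \<open>At \<open>c = real h\<close> this is h (h^2 - 1) / 3, the squared norm of the second
  projection direction.\<close>

lemma sum_affine_squares:
  "(\<Sum>j<h. (2 * real j + 1 - c)\<^sup>2) = real h * (4 * (real h)\<^sup>2 - 1) / 3 - 2 * c * (real h)\<^sup>2 + c\<^sup>2 * real h"
  by (induction h) (simp_all add: power2_eq_square field_simps)

text \<open>Summation by parts: the weights grow by the constant step 2, so the plain sum of the
  values appears.\<close>

lemma sum_affine_differences: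
  fixes s :: "nat \<Rightarrow> real"
  shows "(\<Sum>j<h. (2 * real j + 1 - c) * (s (Suc j) - s j))
    = (2 * real h + 1 - c) * s h + (1 + c) * s 0 - 2 * (\<Sum>j\<le>h. s j)"
  by (induction h) (simp_all add: algebra_simps)

text \<open>Twice the gap between the endpoint average and the mean of all h + 1 samples. This is
  the quantity computed by the second block row of \<open>M_mat\<close>.\<close>

definition midgap :: "nat \<Rightarrow> (nat \<Rightarrow> real) \<Rightarrow> real" where
  "midgap h s = s h + s 0 - 2 * ((\<Sum>j\<le>h. s j) / (real h + 1))"

text \<open>The factor 3 / (h (h - 1)) is the inner product (h + 1) \<open>midgap\<close> of the
  increments with the affine direction, divided by its squared norm h (h^2 - 1) / 3.\<close>

definition wirtinger_residual :: "nat \<Rightarrow> (nat \<Rightarrow> real) \<Rightarrow> nat \<Rightarrow> real" where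
  "wirtinger_residual h s j = (s (Suc j) - s j) - (s h - s 0) / real h
     - (2 * real j + 1 - real h) * (3 / (real h * (real h - 1)) * midgap h s)"

text \<open>Kept free of the Wirtinger constants, so that the induction is pure expansion;
  orthogonality and norms are inserted afterwards.\<close>

lemma sum_product_residuals:
  fixes x y c :: "nat \<Rightarrow> real"
  shows "(\<Sum>j<h. (x j - a - c j * u) * (y j - b - c j * v))
    = (\<Sum>j<h. x j * y j) - b * (\<Sum>j<h. x j) - v * (\<Sum>j<h. c j * x j)
      - a * (\<Sum>j<h. y j) + real h * (a * b) + a * v * (\<Sum>j<h. c j)
      - u * (\<Sum>j<h. c j * y j) + u * b * (\<Sum>j<h. c j) + u * v * (\<Sum>j<h. (c j)\<^sup>2)"
  by (induction h) (simp_all add: algebra_simps power2_eq_square)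

text \<open>The increments of a sequence are projected onto the constant sequence and onto the
  sequence \<open>2j + 1 - h\<close>, which are orthogonal; the coefficients are multiples of \<open>s h - s 0\<close> and
  of \<open>midgap h s\<close>. Stating the Bessel identity in polarised form lets it pass entrywise to an
  arbitrary quadratic form.\<close>

lemma wirtinger_identity:
  fixes s t :: "nat \<Rightarrow> real"
  assumes h: "h \<ge> 2"
  shows "real h * (\<Sum>j<h. (s (Suc j) - s j) * (t (Suc j) - t j))
    = (s h - s 0) * (t h - t 0) + 3 * gamma h * (midgap h s * midgap h t)
      + real h * (\<Sum>j<h. wirtinger_residual h s j * wirtinger_residual h t j)"
proof -
  define H where "H = real h"
  have H: "H \<ge> 2" using h by (simp add: H_def)
  let ?c = "\<lambda>j. 2 * real j + 1 - H"
  have tel: "(\<Sum>j<h. r (Suc j) - r j) = r h - r 0" for r :: "nat \<Rightarrow> real"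
    by (rule sum_lessThan_telescope)
  \<comment> \<open>At \<open>c = H\<close> both boundary coefficients equal H + 1, and the sum of
    the h + 1 values is H + 1 times their mean.\<close>
  have cz: "(\<Sum>j<h. ?c j * (r (Suc j) - r j)) = (H + 1) * midgap h r" for r :: "nat \<Rightarrow> real"
    unfolding sum_affine_differences midgap_def H_def by (simp add: field_simps)
  have c1: "(\<Sum>j<h. ?c j) = 0"
    unfolding sum_affine by (simp add: H_def power2_eq_square)
  have c2: "(\<Sum>j<h. (?c j)\<^sup>2) = H * (H\<^sup>2 - 1) / 3"
    unfolding sum_affine_squares H_def by (simp add: power2_eq_square field_simps)
  have g: "gamma h = (H + 1) / (H - 1)" using h by (simp add: gamma_def H_def)
  define a b u v z where "a = s h - s 0" and "b = t h - t 0" and "u = midgap h s"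
    and "v = midgap h t" and "z = (\<Sum>j<h. (s (Suc j) - s j) * (t (Suc j) - t j))"
  have "(\<Sum>j<h. wirtinger_residual h s j * wirtinger_residual h t j)
     = z - b/H * a - (3 / (H * (H - 1)) * v) * ((H + 1) * u) - a/H * b + H * (a/H * (b/H))
       - (3 / (H * (H - 1)) * u) * ((H + 1) * v)
       + (3 / (H * (H - 1)) * u) * (3 / (H * (H - 1)) * v) * (H * (H\<^sup>2 - 1) / 3)"
    unfolding wirtinger_residual_def sum_product_residuals H_def[symmetric] tel cz c1 c2
      a_def b_def u_def v_def z_def by simp
  also have "\<dots> = z - a * b / H - 3 * (H + 1) / (H * (H - 1)) * (u * v)"
  proof -
    have "(H\<^sup>2 - 1) = (H - 1) * (H + 1)" by (simp add: power2_eq_square algebra_simps)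
    moreover have "H \<noteq> 0" "H - 1 \<noteq> 0" using H by auto
    ultimately show ?thesis by (simp add: divide_simps) (simp add: algebra_simps)
  qed
  finally have e: "(\<Sum>j<h. wirtinger_residual h s j * wirtinger_residual h t j)
    = z - a * b / H - 3 * (H + 1) / (H * (H - 1)) * (u * v)" .
  have "H * z = a * b + 3 * gamma h * (u * v) + H * (z - a * b / H - 3 * (H + 1) / (H * (H - 1)) * (u * v))"
  proof -
    have "H \<noteq> 0" "H - 1 \<noteq> 0" using H by auto
    then show ?thesis unfolding g by (simp add: divide_simps) (simp add: algebra_simps)
  qed
  then show ?thesis unfolding e unfolding H_def a_def b_def u_def v_def z_def .
qed

text \<open>Allows \<open>gamma\<close> to be replaced by 1 on the windows of unknown length, where
  \<open>Zs2\<close> carries the constant weight 3.\<close>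

lemma gamma_ge_1: "h \<ge> 1 \<Longrightarrow> 1 \<le> gamma h"
  by (auto simp: gamma_def field_simps)

text \<open>The polarised identity, weighted by the entries of \<open>Z\<close> and summed, leaves
  the residuals as a sum of nonnegative forms, which is dropped. The case \<open>h = 1\<close> is
  separate, since the identity divides by h - 1; there the \<open>midgap\<close> term
  vanishes.\<close>

lemma discrete_wirtinger:
  fixes f :: "nat \<Rightarrow> nat \<Rightarrow> real"
  assumes Z: "posdef n Z" and h: "h \<ge> 1"
  shows "qform Z (vec n (\<lambda>i. f h i - f 0 i))
      + 3 * gamma h * qform Z (vec n (\<lambda>i. midgap h (\<lambda>j. f j i)))
    \<le> real h * (\<Sum>j<h. qform Z (vec n (\<lambda>i. f (Suc j) i - f j i)))"
proof (cases "h = 1")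
  case True
  have "midgap 1 (\<lambda>j. f j i) = 0" for i by (simp add: midgap_def)
  then have "vec n (\<lambda>i. midgap h (\<lambda>j. f j i)) = 0\<^sub>v n" using True by auto
  moreover have "qform Z (0\<^sub>v n) = 0" using posdef_carrier[OF Z] by (simp add: qform_def)
  ultimately show ?thesis using True by simp
next
  case False
  note q = sum_qform_vec[OF posdef_carrier[OF Z]] and q1 = qform_vec[OF posdef_carrier[OF Z]]
  have "real h * (\<Sum>j<h. qform Z (vec n (\<lambda>i. f (Suc j) i - f j i)))
    = (\<Sum>i<n. \<Sum>j<n. Z $$ (i,j) * (real h * (\<Sum>l<h. (f (Suc l) i - f l i) * (f (Suc l) j - f l j))))"
    unfolding q by (simp add: sum_distrib_left mult_ac)
  also have "\<dots> = (\<Sum>i<n. \<Sum>j<n. Z $$ (i,j) * ((f h i - f 0 i) * (f h j - f 0 j)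
      + 3 * gamma h * (midgap h (\<lambda>l. f l i) * midgap h (\<lambda>l. f l j))
      + real h * (\<Sum>l<h. wirtinger_residual h (\<lambda>l. f l i) l * wirtinger_residual h (\<lambda>l. f l j) l)))"
    using wirtinger_identity[of h "\<lambda>l. f l i" "\<lambda>l. f l j" for i j] False h by simp
  also have "\<dots> = qform Z (vec n (\<lambda>i. f h i - f 0 i))
      + 3 * gamma h * qform Z (vec n (\<lambda>i. midgap h (\<lambda>j. f j i)))
      + real h * (\<Sum>l<h. qform Z (vec n (\<lambda>i. wirtinger_residual h (\<lambda>j. f j i) l)))"
    unfolding q unfolding q1 by (simp add: sum_distrib_left sum.distrib distrib_left mult_ac)
  finally show ?thesis
    using posdef_qform_nonneg[OF Z] by (simp add: sum_nonneg)
qed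

text \<open>For positive \<open>h1\<close>, \<open>h2\<close> the semidefiniteness hypothesis is used at \<open>s = h2\<close>, \<open>t = - h1\<close>.
  A degenerate window forces \<open>a = 0\<close> or \<open>b = 0\<close>, and then the cross term \<open>c\<close> is nonpositive.\<close>

lemma reciprocally_convex:
  fixes a b c u v :: real
  assumes h: "h1 \<ge> 0" "h2 \<ge> 0" "h1 + h2 = D"
    and a: "a \<le> h1 * u" "h1 = 0 \<Longrightarrow> a \<le> 0" and b: "b \<le> h2 * v" "h2 = 0 \<Longrightarrow> b \<le> 0"
    and uv: "u \<ge> 0" "v \<ge> 0"
    and psd: "\<And>s t. 0 \<le> s\<^sup>2 * a + t\<^sup>2 * b + 2 * s * t * c"
  shows "a + b + 2 * c \<le> D * (u + v)"
proof -
  have deg: "c \<le> 0" if "\<And>s t. 0 \<le> t\<^sup>2 * b + 2 * s * t * c" for b c :: real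
  proof (rule ccontr)
    assume "\<not> c \<le> 0"
    \<comment> \<open>At t = 1 this value of s makes the supposedly nonnegative expression equal to
      -1.\<close>
    then show False using that[of 1 "- (b + 1) / (2 * c)"] by (simp add: field_simps)
  qed
  consider "h1 = 0" | "h2 = 0" | "h1 > 0" "h2 > 0" using h by linarith
  then show ?thesis
  proof cases
    case 1
    have "a = 0" using psd[of 1 0] a 1 by auto
    moreover from this have "c \<le> 0" using deg[of b c] psd by simp
    moreover have "0 \<le> D * u" "h2 = D" using 1 h uv by auto
    ultimately show ?thesis using b unfolding distrib_left by simp
  next
    case 2
    have b0: "b = 0" using psd[of 0 1] b 2 by auto
    moreover have "0 \<le> t\<^sup>2 * a + 2 * s * t * c" for s t
      using psd[of t s] b0 by (simp add: mult_ac)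
    then have "c \<le> 0" by (rule deg)
    moreover have "0 \<le> D * v" "h1 = D" using 2 h uv by auto
    ultimately show ?thesis using a unfolding distrib_left by simp
  next
    case 3
    have "2 * (h1 * h2) * c \<le> h2\<^sup>2 * a + h1\<^sup>2 * b" using psd[of h2 "- h1"] by (simp add: mult_ac)
    also have "\<dots> \<le> h2\<^sup>2 * (h1 * u) + h1\<^sup>2 * (h2 * v) "
      using a b by (intro add_mono mult_left_mono) auto
    also have "\<dots> = (h1 * h2) * (h2 * u + h1 * v)" by (simp add: power2_eq_square algebra_simps)
    finally have "(h1 * h2) * (2 * c) \<le> (h1 * h2) * (h2 * u + h1 * v)" by (simp add: mult_ac)
    then have "2 * c \<le> h2 * u + h1 * v" using 3 by (simp add: mult_le_cancel_left)
    \<comment> \<open>The direct products bound \<open>a + b\<close>; the crossed ones were just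
      shown to bound \<open>2 * c\<close>.\<close>
    moreover have "D * (u + v) = h1 * u + h2 * v + (h2 * u + h1 * v)"
      using h(3) by (auto simp: algebra_simps)
    ultimately show ?thesis using a b by linarith
  qed
qed

section \<open>Block matrices acting on stacked vectors\<close>

lemma qform_add:
  "A \<in> carrier_mat k k \<Longrightarrow> B \<in> carrier_mat k k \<Longrightarrow> v \<in> carrier_vec k \<Longrightarrow>
    qform (A + B) v = qform A v + qform B v"
  by (simp add: qform_def add_mult_distrib_mat_vec[of _ k k] scalar_prod_add_distrib[of _ k])

lemma qform_uminus:
  "A \<in> carrier_mat k k \<Longrightarrow> v \<in> carrier_vec k \<Longrightarrow> qform (- A) v = - qform A v"
  by (simp add: qform_def)

lemma qform_minus:
  assumes "A \<in> carrier_mat k k" "B \<in> carrier_mat k k" "v \<in> carrier_vec k"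
  shows "qform (A - B) v = qform A v - qform B v"
proof -
  have "A - B = A + (- B)" using assms by auto
  then show ?thesis using assms by (simp add: qform_add[of _ k] qform_uminus[of _ k])
qed

lemma smult_mat_mult_vec:
  fixes A :: "real mat"
  assumes "dim_col A = dim_vec v"
  shows "(c \<cdot>\<^sub>m A) *\<^sub>v v = c \<cdot>\<^sub>v (A *\<^sub>v v)"
  using assms by (intro eq_vecI) (auto simp: row_def scalar_prod_def sum_distrib_left mult_ac)

lemma qform_smult_mat:
  "A \<in> carrier_mat k k \<Longrightarrow> v \<in> carrier_vec k \<Longrightarrow> qform (c \<cdot>\<^sub>m A) v = c * qform A v"
  by (simp add: qform_def smult_mat_mult_vec)

lemma zero_mat_mult_vec: "dim_vec v = c \<Longrightarrow> 0\<^sub>m r c *\<^sub>v v = vec r (\<lambda>_. 0 :: real)"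
  by (intro eq_vecI) (auto simp: scalar_prod_def)

lemma qform_zero: "v \<in> carrier_vec k \<Longrightarrow> qform (0\<^sub>m k k) v = 0"
  by (simp add: qform_def zero_mat_mult_vec scalar_prod_def)

lemma scalar_prod_transpose_mult:
  assumes "F \<in> carrier_mat r k" "v \<in> carrier_vec k" "w \<in> carrier_vec r"
  shows "v \<bullet> (F\<^sup>T *\<^sub>v w) = (F *\<^sub>v v) \<bullet> (w :: real vec)"
proof -
  have "v \<bullet> (F\<^sup>T *\<^sub>v w) = (F\<^sup>T *\<^sub>v w) \<bullet> v"
    using assms by (intro comm_scalar_prod[of _ k]) auto
  also have "\<dots> = w \<bullet> (F *\<^sub>v v)"
    by (rule transpose_vec_mult_scalar[OF assms])
  also have "\<dots> = (F *\<^sub>v v) \<bullet> w" using assms by (intro comm_scalar_prod[of _ r]) auto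
  finally show ?thesis .
qed

lemma qform_transpose_mult:
  assumes "F \<in> carrier_mat r k" "G \<in> carrier_mat r k" "v \<in> carrier_vec k"
  shows "qform (F\<^sup>T * G) v = (F *\<^sub>v v) \<bullet> (G *\<^sub>v v)"
  using assms scalar_prod_transpose_mult[of F r k v "G *\<^sub>v v"]
  by (simp add: qform_def assoc_mult_mat_vec[of _ k r _ k])

lemma qform_congruence:
  assumes "F \<in> carrier_mat r k" "M \<in> carrier_mat r r" "v \<in> carrier_vec k"
  shows "qform (F\<^sup>T * M * F) v = qform M (F *\<^sub>v v)"
proof -
  have "F\<^sup>T * M * F = F\<^sup>T * (M * F)" using assms by (intro assoc_mult_mat[of _ k r _ r _ k]) auto
  then show ?thesis
    using assms qform_transpose_mult[of F r k "M * F" v]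
    by (simp add: qform_def)
qed

lemma qform_transpose:
  assumes "A \<in> carrier_mat k k" "v \<in> carrier_vec k"
  shows "qform (A\<^sup>T) v = qform A v"
  using assms scalar_prod_transpose_mult[of A k k v v] comm_scalar_prod[of v k "A *\<^sub>v v"]
  by (simp add: qform_def)

lemma qform_He:
  assumes "F \<in> carrier_mat r k" "M \<in> carrier_mat r r" "G \<in> carrier_mat r k" "v \<in> carrier_vec k"
  shows "qform (He (F\<^sup>T * M * G)) v = 2 * ((F *\<^sub>v v) \<bullet> (M *\<^sub>v (G *\<^sub>v v)))"
proof -
  have "F\<^sup>T * M * G = F\<^sup>T * (M * G)" using assms by (intro assoc_mult_mat[of _ k r _ r _ k]) auto
  then show ?thesis
    using assms qform_transpose_mult[of F r k "M * G" v]
    by (simp add: He_def qform_add[of _ k] qform_transpose[of _ k])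
qed

section \<open>Concatenated blocks acting on stacked vectors\<close>

lemma append_vec_assoc: "(a @\<^sub>v b) @\<^sub>v c = a @\<^sub>v (b @\<^sub>v c)"
  by (rule eq_vecI) (auto)

lemma hcat_dim[simp]:
  "dim_row (hcat A B) = dim_row A" "dim_col (hcat A B) = dim_col A + dim_col B"
  by (simp_all add: hcat_def)

lemma vcat_dim[simp]:
  "dim_row (vcat A B) = dim_row A + dim_row B" "dim_col (vcat A B) = dim_col A"
  by (simp_all add: vcat_def)

lemma hcat_mult_vec:
  assumes "dim_col A = dim_vec u" "dim_col B = dim_vec v" "dim_row B = dim_row A"
  shows "hcat A B *\<^sub>v (u @\<^sub>v v) = A *\<^sub>v u + B *\<^sub>v v"
proof (rule eq_vecI)
  fix i assume "i < dim_vec (A *\<^sub>v u + B *\<^sub>v v)"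
  then have i: "i < dim_row A" using assms by simp
  have "row (hcat A B) i = row A i @\<^sub>v row B i"
    using i assms by (intro eq_vecI) (auto simp: hcat_def row_def)
  moreover have "(row A i @\<^sub>v row B i) \<bullet> (u @\<^sub>v v) = row A i \<bullet> u + row B i \<bullet> v"
    using assms by (intro scalar_prod_append[of _ "dim_vec u" _ "dim_vec v"]) (auto intro!: carrier_vecI)
  ultimately show "(hcat A B *\<^sub>v (u @\<^sub>v v)) $ i = (A *\<^sub>v u + B *\<^sub>v v) $ i"
    using i assms by simp
qed (use assms in simp)

lemma vcat_mult_vec:
  assumes "dim_col B = dim_col A"
  shows "vcat A B *\<^sub>v v = (A *\<^sub>v v) @\<^sub>v (B *\<^sub>v v)"
proof (rule eq_vecI)
  fix i assume "i < dim_vec ((A *\<^sub>v v) @\<^sub>v (B *\<^sub>v v))"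
  then have i: "i < dim_row A + dim_row B" by simp
  have "row (vcat A B) i = (if i < dim_row A then row A i else row B (i - dim_row A))"
    using i assms by (auto simp: vcat_def row_def)
  then show "(vcat A B *\<^sub>v v) $ i = ((A *\<^sub>v v) @\<^sub>v (B *\<^sub>v v)) $ i"
    using i by (auto)
qed simp

lemma vec_block_simps[simp]:
  fixes f g :: "nat \<Rightarrow> real"
  shows "vec k f + vec k g = vec k (\<lambda>i. f i + g i)"
    and "vec k f - vec k g = vec k (\<lambda>i. f i - g i)"
    and "- vec k f = vec k (\<lambda>i. - f i)"
    and "c \<cdot>\<^sub>v vec k f = vec k (\<lambda>i. c * f i)"
    and "1\<^sub>m k *\<^sub>v vec k f = vec k f"
    and "(- 1\<^sub>m k) *\<^sub>v vec k f = vec k (\<lambda>i. - f i)"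
    and "(c \<cdot>\<^sub>m 1\<^sub>m k) *\<^sub>v vec k f = vec k (\<lambda>i. c * f i)"
proof -
  show c: "c \<cdot>\<^sub>v vec k f = vec k (\<lambda>i. c * f i)" by auto
  show "(c \<cdot>\<^sub>m 1\<^sub>m k) *\<^sub>v vec k f = vec k (\<lambda>i. c * f i)" by (simp add: smult_mat_mult_vec c)
  show "(- 1\<^sub>m k) *\<^sub>v vec k f = vec k (\<lambda>i. - f i)" by (subst uminus_mult_mat_vec) auto
qed auto

lemma append_vec_plus:
  fixes a b c d :: "real vec"
  assumes "dim_vec a = dim_vec c" "dim_vec b = dim_vec d"
  shows "(a @\<^sub>v b) + (c @\<^sub>v d) = (a + c) @\<^sub>v (b + d)"
  using assms by (intro eq_vecI) (auto)

lemma append_vec_smult: "c \<cdot>\<^sub>v (a @\<^sub>v b) = (c \<cdot>\<^sub>v a) @\<^sub>v (c \<cdot>\<^sub>v (b :: real vec))"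
  by (intro eq_vecI) (auto)

lemma zero_plus_append_vec: "vec k (\<lambda>_. 0) + (a @\<^sub>v b) = a @\<^sub>v (b :: real vec)"
  if "k = dim_vec a + dim_vec b"
  using that by (intro eq_vecI) (auto)

lemma append_vec_plus_zero: "(a @\<^sub>v b) + vec k (\<lambda>_. 0) = a @\<^sub>v (b :: real vec)"
  if "k = dim_vec a + dim_vec b"
  using that by (intro eq_vecI) (auto)

lemmas block_mult_simps = blocks_def hcat_mult_vec vcat_mult_vec zero_mat_mult_vec
  append_vec_plus append_vec_smult zero_plus_append_vec append_vec_plus_zero

lemma block_matrix_dims[simp]:
  "dim_row (M_mat n) = 2*n" "dim_col (M_mat n) = 6*n"
  "dim_row (F_Psi n) = 4*n" "dim_col (F_Psi n) = 8*n"
  "dim_row (F_s n) = 2*n" "dim_col (F_s n) = 8*n"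
  "dim_row (F_3 n) = n" "dim_col (F_3 n) = 8*n"
  "dim_row (F_1 n dm dM) = 3*n" "dim_col (F_1 n dm dM) = 8*n"
  "dim_row (F_2 n dm dM) = 3*n" "dim_col (F_2 n dm dM) = 8*n"
  "dim_row (F_d n d) = 3*n" "dim_col (F_d n d) = 8*n"
  by (simp_all add: M_mat_def F_Psi_def F_s_def F_3_def F_1_def F_2_def F_d_def blocks_def)

text \<open>Nested to the right like \<open>hcats\<close>, so that a block row peels off one block
  at a time; blocks are functions, which reduces block algebra to pointwise arithmetic.\<close>

definition stack8 :: "nat \<Rightarrow> (nat \<Rightarrow> nat \<Rightarrow> real) \<Rightarrow> real vec" where
  "stack8 n x = vec n (x 0) @\<^sub>v (vec n (x 1) @\<^sub>v (vec n (x 2) @\<^sub>v (vec n (x 3) @\<^sub>v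
     (vec n (x 4) @\<^sub>v (vec n (x 5) @\<^sub>v (vec n (x 6) @\<^sub>v vec n (x 7)))))))"

lemma stack8_carrier[simp]: "stack8 n x \<in> carrier_vec (8*n)"
  by (rule carrier_vecI) (simp add: stack8_def)

lemma M_mat_mult_vec:
  "M_mat n *\<^sub>v (vec n a0 @\<^sub>v (vec n a1 @\<^sub>v (vec n a2 @\<^sub>v (vec n a3 @\<^sub>v (vec n a4 @\<^sub>v vec n a5)))))
    = vec n (\<lambda>i. a1 i - a2 i) @\<^sub>v vec n (\<lambda>i. a1 i + a2 i - 2 * a5 i)"
  unfolding M_mat_def by (simp add: block_mult_simps) (simp add: algebra_simps)

lemma F_1_mult_vec:
  "F_1 n dm dM *\<^sub>v stack8 n x = vec n (x 1) @\<^sub>v (vec n (\<lambda>i. - x 1 i + (real dm + 1) * x 5 i) @\<^sub>v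
     vec n (\<lambda>i. - x 2 i - x 3 i + (1 - real dm) * x 6 i + (real dM + 1) * x 7 i))"
  unfolding F_1_def stack8_def by (simp add: block_mult_simps) (simp add: algebra_simps)

lemma F_2_mult_vec:
  "F_2 n dm dM *\<^sub>v stack8 n x = vec n (x 0) @\<^sub>v (vec n (\<lambda>i. - x 2 i + (real dm + 1) * x 5 i) @\<^sub>v
     vec n (\<lambda>i. - x 3 i - x 4 i + (1 - real dm) * x 6 i + (real dM + 1) * x 7 i))"
  unfolding F_2_def stack8_def by (simp add: block_mult_simps) (simp add: algebra_simps)

lemma F_3_mult_vec: "F_3 n *\<^sub>v stack8 n x = vec n (\<lambda>i. x 0 i - x 1 i)"
  unfolding F_3_def stack8_def by (simp add: block_mult_simps)

lemma F_d_mult_vec: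
  "F_d n d *\<^sub>v stack8 n x = vec n (\<lambda>_. 0) @\<^sub>v (vec n (\<lambda>_. 0) @\<^sub>v vec n (\<lambda>i. d * (x 6 i - x 7 i)))"
proof -
  \<comment> \<open>The column widths of \<open>F_d\<close> are 6n, n, n, so the first six blocks
    are bracketed together.\<close>
  have *: "stack8 n x = (vec n (x 0) @\<^sub>v (vec n (x 1) @\<^sub>v (vec n (x 2) @\<^sub>v (vec n (x 3) @\<^sub>v
     (vec n (x 4) @\<^sub>v vec n (x 5)))))) @\<^sub>v (vec n (x 6) @\<^sub>v vec n (x 7))"
    by (simp add: stack8_def append_vec_assoc)
  have z: "vec (2*n) (\<lambda>_. 0) = vec n (\<lambda>_. 0) @\<^sub>v vec n (\<lambda>_. 0 :: real)"
    by (intro eq_vecI) (auto)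
  show ?thesis unfolding F_d_def *
    by (simp add: block_mult_simps z) (simp add: append_vec_assoc algebra_simps)
qed

lemma F_s_mult_vec:
  "F_s n *\<^sub>v stack8 n x = vec n (\<lambda>i. x 1 i - x 2 i) @\<^sub>v vec n (\<lambda>i. x 1 i + x 2 i - 2 * x 5 i)"
proof -
  have *: "stack8 n x = (vec n (x 0) @\<^sub>v (vec n (x 1) @\<^sub>v (vec n (x 2) @\<^sub>v (vec n (x 3) @\<^sub>v
     (vec n (x 4) @\<^sub>v vec n (x 5)))))) @\<^sub>v (vec n (x 6) @\<^sub>v vec n (x 7))"
    by (simp add: stack8_def append_vec_assoc)
  show ?thesis unfolding F_s_def * by (simp add: block_mult_simps M_mat_mult_vec)
qed

text \<open>The blocks of the older window [d, d_M] come first and those of [d_m, d] second; this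
  order fixes which window stands on which side of \<open>X\<close>. The two bracketings of the
  stack follow the two offsets of \<open>M_mat\<close>.\<close>

lemma F_Psi_mult_vec:
  "F_Psi n *\<^sub>v stack8 n x =
     (vec n (\<lambda>i. x 3 i - x 4 i) @\<^sub>v vec n (\<lambda>i. x 3 i + x 4 i - 2 * x 7 i)) @\<^sub>v
     (vec n (\<lambda>i. x 2 i - x 3 i) @\<^sub>v vec n (\<lambda>i. x 2 i + x 3 i - 2 * x 6 i))"
proof -
  have 1: "stack8 n x = (vec n (x 0) @\<^sub>v vec n (x 1)) @\<^sub>v (vec n (x 2) @\<^sub>v (vec n (x 3) @\<^sub>v
     (vec n (x 4) @\<^sub>v (vec n (x 5) @\<^sub>v (vec n (x 6) @\<^sub>v vec n (x 7))))))"
    by (simp add: stack8_def append_vec_assoc)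
  have 2: "stack8 n x = vec n (x 0) @\<^sub>v ((vec n (x 1) @\<^sub>v (vec n (x 2) @\<^sub>v (vec n (x 3) @\<^sub>v
     (vec n (x 4) @\<^sub>v (vec n (x 5) @\<^sub>v vec n (x 6)))))) @\<^sub>v vec n (x 7))"
    by (simp add: stack8_def append_vec_assoc)
  have "F_Psi n *\<^sub>v stack8 n x = (hcat (0\<^sub>m (2*n) (2*n)) (M_mat n) *\<^sub>v stack8 n x) @\<^sub>v
      (hcat (0\<^sub>m (2*n) n) (hcat (M_mat n) (0\<^sub>m (2*n) n)) *\<^sub>v stack8 n x)"
    by (simp add: F_Psi_def blocks_def vcat_mult_vec)
  also have "hcat (0\<^sub>m (2*n) (2*n)) (M_mat n) *\<^sub>v stack8 n x =
      vec n (\<lambda>i. x 3 i - x 4 i) @\<^sub>v vec n (\<lambda>i. x 3 i + x 4 i - 2 * x 7 i)"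
    unfolding 1 by (simp add: block_mult_simps M_mat_mult_vec)
  also have "hcat (0\<^sub>m (2*n) n) (hcat (M_mat n) (0\<^sub>m (2*n) n)) *\<^sub>v stack8 n x =
      vec n (\<lambda>i. x 2 i - x 3 i) @\<^sub>v vec n (\<lambda>i. x 2 i + x 3 i - 2 * x 6 i)"
    unfolding 2 by (simp add: block_mult_simps M_mat_mult_vec)
  finally show ?thesis .
qed

section \<open>Quadratic forms of the weight matrices\<close>

lemma bdiag_Cons:
  "bdiag (A # B # As) = four_block_mat A (0\<^sub>m (dim_row A) (dim_col (bdiag (B # As))))
     (0\<^sub>m (dim_row (bdiag (B # As))) (dim_col A)) (bdiag (B # As))"
  by (simp add: Let_def)

lemma bdiag_dim:
  "dim_row (bdiag (A # B # As)) = dim_row A + dim_row (bdiag (B # As))"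
  "dim_col (bdiag (A # B # As)) = dim_col A + dim_col (bdiag (B # As))"
  by (simp_all add: bdiag_Cons del: bdiag.simps)

lemma bdiag_single: "bdiag [A] = A" by simp

declare bdiag.simps[simp del]

text \<open>Lists of at least two blocks are those for which \<open>bdiag\<close> builds a
  four-block matrix; repeated use peels the diagonal.\<close>

lemma qform_bdiag_Cons:
  assumes "dim_row A = dim_vec a" "dim_col A = dim_vec a"
    and "dim_row (bdiag (B # As)) = dim_vec d" "dim_col (bdiag (B # As)) = dim_vec d"
  shows "qform (bdiag (A # B # As)) (a @\<^sub>v d) = qform A a + qform (bdiag (B # As)) d"
proof -
  have A: "A \<in> carrier_mat (dim_vec a) (dim_vec a)"
    and D: "bdiag (B # As) \<in> carrier_mat (dim_vec d) (dim_vec d)"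
    and a: "a \<in> carrier_vec (dim_vec a)" and d: "d \<in> carrier_vec (dim_vec d)"
    using assms by auto
  have "bdiag (A # B # As) *\<^sub>v (a @\<^sub>v d) = (A *\<^sub>v a) @\<^sub>v (bdiag (B # As) *\<^sub>v d)"
    unfolding bdiag_Cons assms by (rule mult_mat_vec_split[OF A D a d])
  then show ?thesis
    using scalar_prod_append[OF a d, of "A *\<^sub>v a" "bdiag (B # As) *\<^sub>v d"] A D
    by (simp add: qform_def)
qed

lemmas qform_bdiag_simps = qform_bdiag_Cons bdiag_dim bdiag_single

text \<open>The part quadratic in the common shift \<open>w\<close> cancels. With \<open>w\<close>
  the contribution of \<open>F_d\<close>, this makes the increment of the functional affine in the
  delay.\<close>

lemma qform_increment:
  assumes P: "P \<in> carrier_mat k k" "P\<^sup>T = P"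
    and c: "u \<in> carrier_vec k" "v \<in> carrier_vec k" "w \<in> carrier_vec k"
  shows "qform P (u + w) - qform P (v + w) = qform P u - qform P v + 2 * (w \<bullet> (P *\<^sub>v (u - v)))"
proof -
  have sym: "a \<bullet> (P *\<^sub>v b) = b \<bullet> (P *\<^sub>v a)" if "a \<in> carrier_vec k" "b \<in> carrier_vec k" for a b
    using scalar_prod_transpose_mult[OF P(1) that] P(2) that
      comm_scalar_prod[of "P *\<^sub>v a" k b] P(1) by simp
  have ex: "qform P (a + w) = qform P a + 2 * (w \<bullet> (P *\<^sub>v a)) + qform P w"
    if a: "a \<in> carrier_vec k" for a
    using a c(3) P(1) sym[OF a c(3)]
    by (simp add: qform_def mult_add_distrib_mat_vec[of _ k k] scalar_prod_add_distrib[of _ k]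
        add_scalar_prod_distrib[of _ k])
  have "w \<bullet> (P *\<^sub>v (u - v)) = w \<bullet> (P *\<^sub>v u) - w \<bullet> (P *\<^sub>v v)"
    using c P(1) by (simp add: mult_minus_distrib_mat_vec[of _ k k] scalar_prod_minus_distrib[of _ k])
  then show ?thesis using ex[OF c(1)] ex[OF c(2)] by simp
qed

lemma qform_W_mat:
  assumes "W1 \<in> carrier_mat n n" "W2 \<in> carrier_mat n n"
  shows "qform (W_mat n W1 W2) (stack8 n x) = qform W1 (vec n (x 1)) + qform W2 (vec n (x 2))
     - qform W1 (vec n (x 2)) - qform W2 (vec n (x 4))"
  using assms unfolding W_mat_def stack8_def
  by (simp add: qform_bdiag_simps qform_zero qform_minus[of _ n] qform_uminus[of _ n])

lemma qform_Zs1: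
  assumes "Z1 \<in> carrier_mat n n"
  shows "qform (Zs1 dm Z1) (vec n f @\<^sub>v vec n g) = qform Z1 (vec n f) + 3 * gamma dm * qform Z1 (vec n g)"
  using assms unfolding Zs1_def by (simp add: qform_bdiag_simps qform_smult_mat[of _ n])

lemma qform_Zs2:
  assumes "Z2 \<in> carrier_mat n n"
  shows "qform (Zs2 Z2) (vec n f @\<^sub>v vec n g) = qform Z2 (vec n f) + 3 * qform Z2 (vec n g)"
  using assms unfolding Zs2_def by (simp add: qform_bdiag_simps qform_smult_mat[of _ n])

lemma qform_Psi_z:
  assumes Z: "Z2 \<in> carrier_mat n n" and X: "X \<in> carrier_mat (2*n) (2*n)"
    and b: "b \<in> carrier_vec (2*n)" and a: "a \<in> carrier_vec (2*n)"
  shows "qform (Psi_z Z2 X) (b @\<^sub>v a) = qform (Zs2 Z2) b + qform (Zs2 Z2) a + 2 * (b \<bullet> (X *\<^sub>v a))"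
proof -
  have Zs: "Zs2 Z2 \<in> carrier_mat (2*n) (2*n)"
    using Z by (intro carrier_matI) (simp_all add: Zs2_def bdiag_dim bdiag_single)
  have "Psi_z Z2 X *\<^sub>v (b @\<^sub>v a) = (Zs2 Z2 *\<^sub>v b + X *\<^sub>v a) @\<^sub>v (X\<^sup>T *\<^sub>v b + Zs2 Z2 *\<^sub>v a)"
    using Zs X a b by (simp add: Psi_z_def blocks_def vcat_mult_vec hcat_mult_vec)
  moreover have "a \<bullet> (X\<^sup>T *\<^sub>v b) = b \<bullet> (X *\<^sub>v a)"
    using scalar_prod_transpose_mult[OF X a b] comm_scalar_prod[OF b, of "X *\<^sub>v a"] X a by simp
  ultimately show ?thesis
    using Zs X a b
    by (simp add: qform_def scalar_prod_append[of _ "2*n" _ "2*n"] scalar_prod_add_distrib[of _ "2*n"])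
qed

section \<open>The quadratic form of \<Phi>(d)\<close>

lemma matrix_carriers:
  "F_Psi n \<in> carrier_mat (4*n) (8*n)" "F_s n \<in> carrier_mat (2*n) (8*n)"
  "F_3 n \<in> carrier_mat n (8*n)" "F_1 n dm dM \<in> carrier_mat (3*n) (8*n)"
  "F_2 n dm dM \<in> carrier_mat (3*n) (8*n)" "F_d n d \<in> carrier_mat (3*n) (8*n)"
  by (intro carrier_matI; simp)+

lemma He_carrier: "Y \<in> carrier_mat k k \<Longrightarrow> He Y \<in> carrier_mat k k"
  by (simp add: He_def)

lemma weight_carriers:
  assumes "W1 \<in> carrier_mat n n" "W2 \<in> carrier_mat n n" "Z1 \<in> carrier_mat n n" "Z2 \<in> carrier_mat n n"
    "X \<in> carrier_mat (2*n) (2*n)"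
  shows "W_mat n W1 W2 \<in> carrier_mat (8*n) (8*n)" "Zs1 dm Z1 \<in> carrier_mat (2*n) (2*n)"
    "Psi_z Z2 X \<in> carrier_mat (4*n) (4*n)"
  using assms
  by (intro carrier_matI; simp add: W_mat_def Zs1_def Zs2_def Psi_z_def blocks_def bdiag_dim bdiag_single)+

lemma sandwich_carrier:
  "F \<in> carrier_mat r k \<Longrightarrow> M \<in> carrier_mat r r \<Longrightarrow> G \<in> carrier_mat r k \<Longrightarrow> F\<^sup>T * M * G \<in> carrier_mat k k"
  by auto

context
  fixes n :: nat and P W1 W2 Z1 Z2 X :: "real mat"
  assumes P: "P \<in> carrier_mat (3*n) (3*n)" and W: "W1 \<in> carrier_mat n n" "W2 \<in> carrier_mat n n"
    and Z: "Z1 \<in> carrier_mat n n" "Z2 \<in> carrier_mat n n" and X: "X \<in> carrier_mat (2*n) (2*n)"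
begin

lemma Phi_carrier: "Phi n dm dM P W1 W2 Z1 Z2 X d \<in> carrier_mat (8*n) (8*n)"
  unfolding Phi_def
  \<comment> \<open>A difference takes its dimensions from the subtrahend, so the last term of
    \<open>Phi\<close> settles the carrier.\<close>
  by (intro minus_carrier_mat
      sandwich_carrier[OF matrix_carriers(1) weight_carriers(3)[OF W Z X] matrix_carriers(1)])

lemma qform_Phi:
  fixes x :: "nat \<Rightarrow> nat \<Rightarrow> real" and dm dM :: nat and d :: real
  defines "v \<equiv> stack8 n x"
  shows "qform (Phi n dm dM P W1 W2 Z1 Z2 X d) v =
     qform P (F_2 n dm dM *\<^sub>v v) - qform P (F_1 n dm dM *\<^sub>v v)
     + 2 * ((F_d n d *\<^sub>v v) \<bullet> (P *\<^sub>v (F_2 n dm dM *\<^sub>v v - F_1 n dm dM *\<^sub>v v)))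
     + (qform W1 (vec n (x 1)) + qform W2 (vec n (x 2)) - qform W1 (vec n (x 2)) - qform W2 (vec n (x 4)))
     + ((real dm)\<^sup>2 * qform Z1 (vec n (\<lambda>i. x 0 i - x 1 i))
        + (real dM - real dm)\<^sup>2 * qform Z2 (vec n (\<lambda>i. x 0 i - x 1 i)))
     - (qform Z1 (vec n (\<lambda>i. x 1 i - x 2 i)) + 3 * gamma dm * qform Z1 (vec n (\<lambda>i. x 1 i + x 2 i - 2 * x 5 i)))
     - qform (Psi_z Z2 X) (F_Psi n *\<^sub>v v)"
proof -
  have v: "v \<in> carrier_vec (8*n)" by (simp add: v_def)
  note F = matrix_carriers[of n] and K = weight_carriers[OF W Z X]
  note C = sandwich_carrier
  have Zc: "(real dm)\<^sup>2 \<cdot>\<^sub>m Z1 + (real dM - real dm)\<^sup>2 \<cdot>\<^sub>m Z2 \<in> carrier_mat n n" using Z by auto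
  have Fm: "F_2 n dm dM - F_1 n dm dM \<in> carrier_mat (3*n) (8*n)" using F by auto
  note C1 = C[OF F(5) P F(5)] C[OF F(4) P F(4)] C[OF F(6) P Fm] C[OF F(3) Zc F(3)]
    C[OF F(2) K(2) F(2)] C[OF F(1) K(3) F(1)] He_carrier K(1)
  have "qform (Phi n dm dM P W1 W2 Z1 Z2 X d) v =
     qform P (F_2 n dm dM *\<^sub>v v) - qform P (F_1 n dm dM *\<^sub>v v)
     + 2 * ((F_d n d *\<^sub>v v) \<bullet> (P *\<^sub>v ((F_2 n dm dM - F_1 n dm dM) *\<^sub>v v)))
     + qform (W_mat n W1 W2) v
     + qform ((real dm)\<^sup>2 \<cdot>\<^sub>m Z1 + (real dM - real dm)\<^sup>2 \<cdot>\<^sub>m Z2) (F_3 n *\<^sub>v v)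
     - qform (Zs1 dm Z1) (F_s n *\<^sub>v v) - qform (Psi_z Z2 X) (F_Psi n *\<^sub>v v)"
    unfolding Phi_def
    by (simp only: qform_add[of _ "8*n"] qform_minus[of _ "8*n"] add_carrier_mat minus_carrier_mat v C1
        qform_congruence[OF F(5) P v] qform_congruence[OF F(4) P v] qform_He[OF F(6) P Fm v]
        qform_congruence[OF F(3) Zc v] qform_congruence[OF F(2) K(2) v] qform_congruence[OF F(1) K(3) v])
  moreover have "(F_2 n dm dM - F_1 n dm dM) *\<^sub>v v = F_2 n dm dM *\<^sub>v v - F_1 n dm dM *\<^sub>v v"
    using F v by (intro minus_mult_distrib_mat_vec)
  ultimately show ?thesis
    using Z W unfolding v_def F_3_mult_vec F_s_mult_vec qform_W_mat[OF W] qform_Zs1[OF Z(1)]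
    by (simp add: qform_add[of _ n] qform_smult_mat[of _ n])
qed

text \<open>The delay enters only through the \<open>He\<close> term, and \<open>F_d\<close> is
  linear in it.\<close>

lemma qform_Phi_affine:
  "\<exists>a b. \<forall>d. qform (Phi n dm dM P W1 W2 Z1 Z2 X d) (stack8 n x) = a + d * b"
proof -
  let ?v = "stack8 n x" let ?y = "P *\<^sub>v (F_2 n dm dM *\<^sub>v ?v - F_1 n dm dM *\<^sub>v ?v)"
  have *: "F_d n d *\<^sub>v ?v = d \<cdot>\<^sub>v (F_d n 1 *\<^sub>v ?v)" for d
    by (simp add: F_d_mult_vec append_vec_smult)
  define c where "c = (F_d n 1 *\<^sub>v ?v) \<bullet> ?y"
  have "(F_d n d *\<^sub>v ?v) \<bullet> ?y = d * c" for d
    unfolding *[of d] c_def using P by simp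
  then have "qform (Phi n dm dM P W1 W2 Z1 Z2 X d) ?v =
    qform (Phi n dm dM P W1 W2 Z1 Z2 X 0) ?v + d * (2 * c)" for d
    unfolding qform_Phi by simp
  then show ?thesis by blast
qed

end

section \<open>Eliminating the input\<close>

text \<open>A kernel vector would make the form vanish, so the determinant is nonzero. Hence
  \<open>mat_inverse\<close> succeeds and \<open>the\<close> extracts a genuine inverse.\<close>

lemma posdef_mat_inverse:
  assumes "posdef m R"
  shows "the (mat_inverse R) \<in> carrier_mat m m" "R * the (mat_inverse R) = 1\<^sub>m m"
proof -
  note R = posdef_carrier[OF assms]
  have "det R \<noteq> 0"
  proof
    assume "det R = 0"
    then obtain v where v: "v \<in> carrier_vec m" "v \<noteq> 0\<^sub>v m" "R *\<^sub>v v = 0\<^sub>v m"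
      using det_0_iff_vec_prod_zero_field[OF R] by auto
    then have "v \<bullet> (R *\<^sub>v v) = 0" by simp
    with v assms show False by (force simp: posdef_def)
  qed
  then have "R \<in> Units (ring_mat TYPE(real) m ())" by (rule det_non_zero_imp_unit[OF R])
  then obtain R' where "mat_inverse R = Some R'"
    using mat_inverse(1)[OF R, where b = "()"] by (cases "mat_inverse R") auto
  with mat_inverse(2)[OF R this]
  show "the (mat_inverse R) \<in> carrier_mat m m" "R * the (mat_inverse R) = 1\<^sub>m m" by auto
qed

text \<open>With w = L y the tested inequality reads \<open>qform Q y - 2 * (w \<bullet> (R
  *\<^sub>v u)) + qform R w \<le> 0\<close>. Completing the square in w gives
  \<open>qform Q y \<le> qform R u\<close>, and this is the claim because
  \<open>y \<bullet> (S *\<^sub>v u) = - qform R u\<close>.\<close>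

lemma sof_dissipation:
  assumes R: "posdef m R" and Q: "Q \<in> carrier_mat p p" and S: "S \<in> carrier_mat p m"
    and LMI: "negdef (p + m) (LMI3 p m \<rho> Q R S)"
    and y: "y \<in> carrier_vec p" and u: "u \<in> carrier_vec m" and Ru: "R *\<^sub>v u = - (S\<^sup>T *\<^sub>v y)"
  shows "qform Q y + 2 * (y \<bullet> (S *\<^sub>v u)) + qform R u \<le> 0"
proof -
  note Rc = posdef_carrier[OF R] and Rt = posdef_transpose[OF R]
  define L where "L = \<rho> \<cdot>\<^sub>m ones m p"
  have L: "L \<in> carrier_mat m p" by (simp add: L_def ones_def)
  have Lt: "\<rho> \<cdot>\<^sub>m ones p m = L\<^sup>T" by (auto simp: L_def ones_def)
  define w where "w = L *\<^sub>v y"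
  have w: "w \<in> carrier_vec m" using L y by (simp add: w_def)
  define T where "T = Q + L\<^sup>T * S\<^sup>T + S * L"
  have T: "T \<in> carrier_mat p p" using Q L S by (auto simp: T_def)
  have Sy: "S\<^sup>T *\<^sub>v y \<in> carrier_vec m" using S y by simp
  have Rw: "(R\<^sup>T * L) *\<^sub>v y = R *\<^sub>v w" using Rc L y by (simp add: Rt w_def)
  have "LMI3 p m \<rho> Q R S *\<^sub>v (y @\<^sub>v w)
      = (T *\<^sub>v y + (R\<^sup>T * L)\<^sup>T *\<^sub>v w) @\<^sub>v ((R\<^sup>T * L) *\<^sub>v y + (- R) *\<^sub>v w)"
    unfolding LMI3_def Let_def Lt L_def[symmetric] T_def[symmetric]
    using T L Rc y w by (simp add: blocks_def vcat_mult_vec hcat_mult_vec)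
  \<comment> \<open>This cancellation is the reason for testing on (y, L y): the second block
    becomes R L y - R w = 0.\<close>
  also have "\<dots> = (T *\<^sub>v y + (R\<^sup>T * L)\<^sup>T *\<^sub>v w) @\<^sub>v 0\<^sub>v m"
    using Rc w unfolding Rw by auto
  finally have LM: "LMI3 p m \<rho> Q R S *\<^sub>v (y @\<^sub>v w) = (T *\<^sub>v y + (R\<^sup>T * L)\<^sup>T *\<^sub>v w) @\<^sub>v 0\<^sub>v m" .
  have Nw: "(R\<^sup>T * L)\<^sup>T *\<^sub>v w \<in> carrier_vec p"
    using Rc L w by (intro mult_mat_vec_carrier[of _ p m]) auto
  have "qform (LMI3 p m \<rho> Q R S) (y @\<^sub>v w) = y \<bullet> (T *\<^sub>v y + (R\<^sup>T * L)\<^sup>T *\<^sub>v w)"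
    using scalar_prod_append[of y p w m "T *\<^sub>v y + (R\<^sup>T * L)\<^sup>T *\<^sub>v w" "0\<^sub>v m"] T Nw y w
    by (simp add: qform_def LM)
  also have "\<dots> = qform T y + y \<bullet> ((R\<^sup>T * L)\<^sup>T *\<^sub>v w)"
    using T Nw y by (simp add: qform_def scalar_prod_add_distrib[of _ p])
  also have "y \<bullet> ((R\<^sup>T * L)\<^sup>T *\<^sub>v w) = qform R w"
    using scalar_prod_transpose_mult[of "R\<^sup>T * L" m p y w] Rc L y w Rw
      comm_scalar_prod[of "R *\<^sub>v w" m w] by (simp add: qform_def)
  also have "qform T y = qform Q y + 2 * (w \<bullet> (S\<^sup>T *\<^sub>v y))"
  proof -
    have "qform (L\<^sup>T * S\<^sup>T) y = w \<bullet> (S\<^sup>T *\<^sub>v y)"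
      using qform_transpose_mult[OF L _ y, of "S\<^sup>T"] S by (simp add: w_def)
    moreover have "(S * L)\<^sup>T = L\<^sup>T * S\<^sup>T" using S L by (rule transpose_mult)
    then have "qform (S * L) y = qform (L\<^sup>T * S\<^sup>T) y"
      using qform_transpose[of "S * L" p y] S L y by simp
    ultimately show ?thesis using Q L S y by (simp add: T_def qform_add[of _ p])
  qed
  also have "w \<bullet> (S\<^sup>T *\<^sub>v y) = - (w \<bullet> (R *\<^sub>v u))"
    using S w by (simp add: Ru)
  finally have q: "qform (LMI3 p m \<rho> Q R S) (y @\<^sub>v w)
    = qform Q y + 2 * - (w \<bullet> (R *\<^sub>v u)) + qform R w" .
  have "- LMI3 p m \<rho> Q R S \<in> carrier_mat (p + m) (p + m)"
    using LMI posdef_carrier unfolding negdef_def by blast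
  then have "LMI3 p m \<rho> Q R S \<in> carrier_mat (p + m) (p + m)" by auto
  moreover have "0 \<le> qform (- LMI3 p m \<rho> Q R S) (y @\<^sub>v w)"
    using LMI y w unfolding negdef_def by (intro posdef_qform_nonneg) auto
  ultimately have le: "qform (LMI3 p m \<rho> Q R S) (y @\<^sub>v w) \<le> 0"
    using y w by (simp add: qform_uminus[of _ "p + m"])
  have "0 \<le> qform R (w - u)" using w u by (intro posdef_qform_nonneg[OF R]) auto
  also have "qform R (w - u) = qform R w - 2 * (w \<bullet> (R *\<^sub>v u)) + qform R u"
  proof -
    have "u \<bullet> (R *\<^sub>v w) = w \<bullet> (R *\<^sub>v u)"
      using scalar_prod_transpose_mult[OF Rc u w] comm_scalar_prod[of "R *\<^sub>v u" m w] Rc Rt u w by simp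
    then show ?thesis
      using Rc u w by (simp add: qform_def mult_minus_distrib_mat_vec[of _ m m]
          scalar_prod_minus_distrib[of _ m] minus_scalar_prod_distrib[of _ m])
  qed
  finally have "2 * (w \<bullet> (R *\<^sub>v u)) \<le> qform R w + qform R u" by simp
  moreover have "y \<bullet> (S *\<^sub>v u) = - qform R u"
  proof -
    have "y \<bullet> (S *\<^sub>v u) = (S\<^sup>T *\<^sub>v y) \<bullet> u"
      using scalar_prod_transpose_mult[of "S\<^sup>T" m p y u] S y u by simp
    also have "\<dots> = u \<bullet> (S\<^sup>T *\<^sub>v y)" using Sy u by (rule comm_scalar_prod)
    also have "\<dots> = - qform R u" using S u by (simp add: qform_def Ru)
    finally show ?thesis .
  qed
  ultimately show ?thesis using q le by simp
qed

section \<open>The closed-loop constraint and the vertex estimate\<close>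

definition stack_tail :: "nat \<Rightarrow> (nat \<Rightarrow> nat \<Rightarrow> real) \<Rightarrow> real vec" where
  "stack_tail n x = vec n (x 2) @\<^sub>v (vec n (x 3) @\<^sub>v
     (vec n (x 4) @\<^sub>v (vec n (x 5) @\<^sub>v (vec n (x 6) @\<^sub>v vec n (x 7)))))"

text \<open>\<open>Gamma_perp\<close> parametrises the vectors compatible with the dynamics: its
  identity part copies the free blocks and its top row supplies x(k+1).\<close>

lemma Gamma_perp_mult_vec:
  assumes A: "A \<in> carrier_mat n n" and B: "B \<in> carrier_mat n m" and u: "u \<in> carrier_vec m"
    and x0: "vec n (x 0) = A *\<^sub>v vec n (x 1) + B *\<^sub>v u"
  shows "Gamma_perp n m A B *\<^sub>v (vec n (x 1) @\<^sub>v (stack_tail n x @\<^sub>v u)) = stack8 n x @\<^sub>v u"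
proof -
  have Bu: "vec n (\<lambda>_. 0) + B *\<^sub>v u = B *\<^sub>v u" using B by (intro eq_vecI) auto
  have "1\<^sub>m (7*n + m) *\<^sub>v (vec n (x 1) @\<^sub>v (stack_tail n x @\<^sub>v u)) = vec n (x 1) @\<^sub>v (stack_tail n x @\<^sub>v u)"
    using u by (intro one_mult_mat_vec carrier_vecI) (simp add: stack_tail_def)
  moreover have "hcats [A, 0\<^sub>m n (6*n), B] *\<^sub>v (vec n (x 1) @\<^sub>v (stack_tail n x @\<^sub>v u)) = vec n (x 0)"
  proof -
    have "dim_vec (stack_tail n x) = 6*n" by (simp add: stack_tail_def)
    then show ?thesis
      using A B u by (simp add: hcat_mult_vec zero_mat_mult_vec Bu x0)
  qed
  ultimately show ?thesis
    using A B unfolding Gamma_perp_def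
    by (simp add: vcat_mult_vec) (simp add: stack_tail_def stack8_def append_vec_assoc)
qed

text \<open>Block 3 of the stack is the delayed state, so \<open>y\<close> is the output on which
  the applied input depends. The value is minus the expression bounded in
  \<open>sof_dissipation\<close>.\<close>

lemma qform_Upsilon:
  fixes x :: "nat \<Rightarrow> nat \<Rightarrow> real"
  assumes C: "C \<in> carrier_mat p n" and Q: "Q \<in> carrier_mat p p" and R: "R \<in> carrier_mat m m"
    and S: "S \<in> carrier_mat p m" and u: "u \<in> carrier_vec m"
  defines "y \<equiv> C *\<^sub>v vec n (x 3)"
  shows "Upsilon n m C Q R S \<in> carrier_mat (8*n + m) (8*n + m)"
    and "qform (Upsilon n m C Q R S) (stack8 n x @\<^sub>v u)
      = - (qform Q y + 2 * (y \<bullet> (S *\<^sub>v u)) + qform R u)"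
proof -
  define U1 where "U1 = bdiag [0\<^sub>m (3*n) (3*n), - (C\<^sup>T * Q * C), 0\<^sub>m (4*n) (4*n), - R]"
  define E where "E = hcats [0\<^sub>m n (3*n), Iblk n, 0\<^sub>m n (4*n + m)]"
  define G where "G = hcats [0\<^sub>m n (8*n), - (C\<^sup>T * S)]"
  have U: "Upsilon n m C Q R S = U1 + E\<^sup>T * G + (E\<^sup>T * G)\<^sup>T"
    by (simp add: Upsilon_def Let_def U1_def E_def G_def)
  have U1: "U1 \<in> carrier_mat (8*n + m) (8*n + m)"
    using C R by (intro carrier_matI) (simp_all add: U1_def bdiag_dim bdiag_single)
  have E: "E \<in> carrier_mat n (8*n + m)" by (intro carrier_matI) (simp_all add: E_def)
  have G: "G \<in> carrier_mat n (8*n + m)" using C S by (intro carrier_matI) (simp_all add: G_def)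
  have EG: "E\<^sup>T * G \<in> carrier_mat (8*n + m) (8*n + m)" using E G by auto
  show "Upsilon n m C Q R S \<in> carrier_mat (8*n + m) (8*n + m)" unfolding U using EG by auto
  let ?a = "vec n (x 0) @\<^sub>v (vec n (x 1) @\<^sub>v vec n (x 2))"
  let ?b = "vec n (x 4) @\<^sub>v (vec n (x 5) @\<^sub>v (vec n (x 6) @\<^sub>v vec n (x 7)))"
  let ?x = "vec n (x 3)"
  \<comment> \<open>Regrouped to the sizes 3n, n, 4n, m of the diagonal blocks of
    \<open>U1\<close>.\<close>
  have v: "stack8 n x @\<^sub>v u = ?a @\<^sub>v (?x @\<^sub>v (?b @\<^sub>v u))" by (simp add: stack8_def append_vec_assoc)
  have vc: "stack8 n x @\<^sub>v u \<in> carrier_vec (8*n + m)" using u by simp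
  have "qform U1 (stack8 n x @\<^sub>v u)
      = qform (0\<^sub>m (3*n) (3*n)) ?a + (qform (- (C\<^sup>T * Q * C)) ?x + (qform (0\<^sub>m (4*n) (4*n)) ?b + qform (- R) u))"
    unfolding v U1_def using C R u by (simp add: qform_bdiag_simps)
  also have "\<dots> = - qform Q y - qform R u"
  proof -
    have "?a \<in> carrier_vec (3*n)" "?b \<in> carrier_vec (4*n)" by (intro carrier_vecI; simp)+
    moreover have "qform (- (C\<^sup>T * Q * C)) ?x = - qform Q y"
      using qform_congruence[OF C Q, of ?x] C Q
      by (simp add: y_def qform_uminus[of _ n] sandwich_carrier)
    moreover have "qform (- R) u = - qform R u" using R u by (rule qform_uminus)
    ultimately show ?thesis by (simp add: qform_zero)
  qed
  finally have 1: "qform U1 (stack8 n x @\<^sub>v u) = - qform Q y - qform R u" .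
  have "E *\<^sub>v (stack8 n x @\<^sub>v u) = ?x"
    unfolding v E_def using u by (simp add: hcat_mult_vec zero_mat_mult_vec)
  moreover have "G *\<^sub>v (stack8 n x @\<^sub>v u) = - (C\<^sup>T *\<^sub>v (S *\<^sub>v u))"
  proof -
    have "G *\<^sub>v (stack8 n x @\<^sub>v u) = vec n (\<lambda>_. 0) + (- (C\<^sup>T * S)) *\<^sub>v u"
      unfolding G_def hcats.simps using C S u
      by (subst hcat_mult_vec) (simp_all add: zero_mat_mult_vec stack8_def)
    also have "(- (C\<^sup>T * S)) *\<^sub>v u = - (C\<^sup>T *\<^sub>v (S *\<^sub>v u))"
      using C S u by (subst uminus_mult_mat_vec) auto
    also have "vec n (\<lambda>_. 0) + \<dots> = \<dots>" using C by (intro eq_vecI) auto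
    finally show ?thesis .
  qed
  ultimately have "qform (E\<^sup>T * G) (stack8 n x @\<^sub>v u) = ?x \<bullet> (- (C\<^sup>T *\<^sub>v (S *\<^sub>v u)))"
    using qform_transpose_mult[OF E G vc] by simp
  also have "\<dots> = - (?x \<bullet> (C\<^sup>T *\<^sub>v (S *\<^sub>v u)))" using C by (intro scalar_prod_uminus_right) simp
  also have "\<dots> = - (y \<bullet> (S *\<^sub>v u))"
    using scalar_prod_transpose_mult[OF C, of ?x "S *\<^sub>v u"] S u by (simp add: y_def)
  finally have 2: "qform (E\<^sup>T * G) (stack8 n x @\<^sub>v u) = - (y \<bullet> (S *\<^sub>v u))" .
  have "qform (Upsilon n m C Q R S) (stack8 n x @\<^sub>v u)
    = qform U1 (stack8 n x @\<^sub>v u) + qform (E\<^sup>T * G) (stack8 n x @\<^sub>v u) + qform (E\<^sup>T * G) (stack8 n x @\<^sub>v u)"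
    unfolding U using U1 EG vc by (simp add: qform_add[of _ "8*n + m"] qform_transpose[of _ "8*n + m"])
  then show "qform (Upsilon n m C Q R S) (stack8 n x @\<^sub>v u)
      = - (qform Q y + 2 * (y \<bullet> (S *\<^sub>v u)) + qform R u)"
    using 1 2 by simp
qed

lemma qform_Phi_negative_at_vertex:
  assumes A: "A \<in> carrier_mat n n" and B: "B \<in> carrier_mat n m" and C: "C \<in> carrier_mat p n"
    and P: "P \<in> carrier_mat (3*n) (3*n)" and W: "W1 \<in> carrier_mat n n" "W2 \<in> carrier_mat n n"
    and Z: "Z1 \<in> carrier_mat n n" "Z2 \<in> carrier_mat n n" and X: "X \<in> carrier_mat (2*n) (2*n)"
    and R: "posdef m R" and Q: "Q \<in> carrier_mat p p" and S: "S \<in> carrier_mat p m"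
    and LMI: "negdef (7*n + m) ((Gamma_perp n m A B)\<^sup>T
          * (Phi_bar n m dm dM P W1 W2 Z1 Z2 X d + Upsilon n m C Q R S) * Gamma_perp n m A B)"
    and LMI_3: "negdef (p + m) (LMI3 p m \<rho> Q R S)"
  shows "\<exists>e>0. \<forall>x u. u \<in> carrier_vec m \<longrightarrow> vec n (x 0) = A *\<^sub>v vec n (x 1) + B *\<^sub>v u \<longrightarrow>
     R *\<^sub>v u = - (S\<^sup>T *\<^sub>v (C *\<^sub>v vec n (x 3))) \<longrightarrow>
     qform (Phi n dm dM P W1 W2 Z1 Z2 X d) (stack8 n x) \<le> - e * (\<Sum>i<n. (x 1 i)\<^sup>2)"
proof -
  let ?G = "Gamma_perp n m A B"
  let ?K = "Phi_bar n m dm dM P W1 W2 Z1 Z2 X d + Upsilon n m C Q R S"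
  note Rc = posdef_carrier[OF R]
  have G: "?G \<in> carrier_mat (8*n + m) (7*n + m)"
    using A B by (intro carrier_matI) (simp_all add: Gamma_perp_def)
  note Ph = Phi_carrier[OF P W Z X, of dm dM d]
  have Pb: "Phi_bar n m dm dM P W1 W2 Z1 Z2 X d \<in> carrier_mat (8*n + m) (8*n + m)"
    using Ph by (intro carrier_matI) (simp_all add: Phi_bar_def bdiag_dim bdiag_single)
  have K: "?K \<in> carrier_mat (8*n + m) (8*n + m)"
    using qform_Upsilon(1)[OF C Q Rc S zero_carrier_vec] Pb by auto
  obtain e where e: "e > 0" and
    co: "\<And>v. v \<in> carrier_vec (7*n + m) \<Longrightarrow> e * (v \<bullet> v) \<le> qform (- (?G\<^sup>T * ?K * ?G)) v"
    using posdef_coercive[OF LMI[unfolded negdef_def]] by blast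
  have "qform (Phi n dm dM P W1 W2 Z1 Z2 X d) (stack8 n x) \<le> - e * (\<Sum>i<n. (x 1 i)\<^sup>2)"
    if u: "u \<in> carrier_vec m" and x0: "vec n (x 0) = A *\<^sub>v vec n (x 1) + B *\<^sub>v u"
      and Ru: "R *\<^sub>v u = - (S\<^sup>T *\<^sub>v (C *\<^sub>v vec n (x 3)))" for x u
  proof -
    let ?v = "vec n (x 1) @\<^sub>v (stack_tail n x @\<^sub>v u)"
    let ?y = "C *\<^sub>v vec n (x 3)"
    have x7: "stack_tail n x \<in> carrier_vec (6*n)" by (intro carrier_vecI) (simp add: stack_tail_def)
    have v: "?v \<in> carrier_vec (7*n + m)" using x7 u by (intro carrier_vecI) simp
    have sq: "0 \<le> w \<bullet> w" for w :: "real vec" by (simp add: scalar_prod_def sum_nonneg)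
    have "?v \<bullet> ?v = vec n (x 1) \<bullet> vec n (x 1) + (stack_tail n x @\<^sub>v u) \<bullet> (stack_tail n x @\<^sub>v u)"
      using x7 u by (intro scalar_prod_append[of _ n _ "6*n + m"]) auto
    \<comment> \<open>Of the full coercivity bound only the current state is kept.\<close>
    then have le: "(\<Sum>i<n. (x 1 i)\<^sup>2) \<le> ?v \<bullet> ?v" by (simp add: sum_squares_vec sq)
    have "qform ?K (stack8 n x @\<^sub>v u) = qform (?G\<^sup>T * ?K * ?G) ?v"
      using qform_congruence[OF G K v] Gamma_perp_mult_vec[OF A B u x0] by simp
    also have "\<dots> \<le> - e * (?v \<bullet> ?v)"
      using co[OF v] sandwich_carrier[OF G K G] v by (simp add: qform_uminus[of _ "7*n + m"])
    also have "\<dots> \<le> - e * (\<Sum>i<n. (x 1 i)\<^sup>2)" using le e by simp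
    finally have 1: "qform ?K (stack8 n x @\<^sub>v u) \<le> - e * (\<Sum>i<n. (x 1 i)\<^sup>2)" .
    have d8: "dim_vec (stack8 n x) = 8*n" by (simp add: stack8_def)
    have "qform (Phi_bar n m dm dM P W1 W2 Z1 Z2 X d) (stack8 n x @\<^sub>v u)
      = qform (Phi n dm dM P W1 W2 Z1 Z2 X d) (stack8 n x)"
      using Ph u by (simp add: Phi_bar_def qform_bdiag_simps d8 qform_zero)
    moreover have "qform ?K (stack8 n x @\<^sub>v u) = qform (Phi_bar n m dm dM P W1 W2 Z1 Z2 X d) (stack8 n x @\<^sub>v u)
      + qform (Upsilon n m C Q R S) (stack8 n x @\<^sub>v u)"
      using Pb qform_Upsilon(1)[OF C Q Rc S u] u by (intro qform_add) auto
    moreover have "0 \<le> qform (Upsilon n m C Q R S) (stack8 n x @\<^sub>v u)"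
      unfolding qform_Upsilon(2)[OF C Q Rc S u]
      using sof_dissipation[OF R Q S LMI_3 _ u Ru] C by simp
    ultimately show ?thesis using 1 by simp
  qed
  with e show ?thesis by blast
qed

section \<open>The Lyapunov functional\<close>

text \<open>Closed windows contain both endpoint lags, as the means in the stack require; the
  functional itself sums over half-open windows.\<close>

definition lagsum :: "(int \<Rightarrow> nat \<Rightarrow> real) \<Rightarrow> int \<Rightarrow> nat \<Rightarrow> nat \<Rightarrow> nat \<Rightarrow> real" where
  "lagsum f k a b i = (\<Sum>j\<in>{a..b}. f (k - int j) i)"

definition lagmean :: "(int \<Rightarrow> nat \<Rightarrow> real) \<Rightarrow> int \<Rightarrow> nat \<Rightarrow> nat \<Rightarrow> nat \<Rightarrow> real" where
  "lagmean f k a b i = lagsum f k a b i / (real b - real a + 1)"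

definition incr :: "(int \<Rightarrow> nat \<Rightarrow> real) \<Rightarrow> int \<Rightarrow> nat \<Rightarrow> real" where
  "incr f k i = f k i - f (k - 1) i"

text \<open>Lags run backwards in time, so the window is reindexed forwards from its oldest sample,
  at lag \<open>b\<close>.\<close>

lemma wirtinger_lag:
  assumes Z: "posdef n Z" and ab: "a < b"
  shows "qform Z (vec n (\<lambda>i. f (k - int a) i - f (k - int b) i))
      + 3 * gamma (b - a) * qform Z (vec n (\<lambda>i. f (k - int a) i + f (k - int b) i - 2 * lagmean f k a b i))
    \<le> (real b - real a) * (\<Sum>j\<in>{a..<b}. qform Z (vec n (incr f (k - int j))))"
proof -
  define s where "s j = f (k - int b + int j)" for j
  have mg: "midgap (b - a) (\<lambda>j. s j i) = f (k - int a) i + f (k - int b) i - 2 * lagmean f k a b i" for i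
  proof -
    have "(\<Sum>j\<le>b - a. s j i) = lagsum f k a b i"
      unfolding lagsum_def s_def
      by (rule sum.reindex_bij_witness[where i = "\<lambda>j. b - j" and j = "\<lambda>j. b - j"]) (use ab in \<open>auto simp: algebra_simps\<close>)
    then show ?thesis using ab by (simp add: midgap_def lagmean_def s_def of_nat_diff)
  qed
  have "(\<Sum>j<b - a. qform Z (vec n (\<lambda>i. s (Suc j) i - s j i)))
      = (\<Sum>j\<in>{a..<b}. qform Z (vec n (incr f (k - int j))))"
  \<comment> \<open>The b - a increments have lags a to b - 1, hence the reversal j to b - 1 -
    j.\<close>
  proof (rule sum.reindex_bij_witness[where i = "\<lambda>j. b - 1 - j" and j = "\<lambda>j. b - 1 - j"])
    fix j assume "j \<in> {..<b - a}"
    then have e: "int (b - 1 - j) = int b - 1 - int j" using ab by auto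
    show "qform Z (vec n (incr f (k - int (b - 1 - j)))) = qform Z (vec n (\<lambda>i. s (Suc j) i - s j i))"
      unfolding e s_def incr_def by (simp add: algebra_simps)
  qed (use ab in auto)
  with discrete_wirtinger[OF Z, of "b - a" s] ab show ?thesis
    unfolding mg by (simp add: s_def of_nat_diff)
qed

lemma sum_lag_shift:
  fixes g :: "int \<Rightarrow> real"
  assumes "a \<le> b"
  shows "(\<Sum>j\<in>{a..<b}. g (k - int j)) - (\<Sum>j\<in>{a..<b}. g (k - 1 - int j)) = g (k - int a) - g (k - int b)"
  using sum_Suc_diff'[OF assms, of "\<lambda>j. g (k - int j)"]
  by (simp add: sum_subtractf algebra_simps)

text \<open>Each inner sum gains the newest term and loses the one at lag \<open>j\<close>; there
  are b - a inner sums.\<close>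

lemma double_sum_lag_shift:
  fixes g :: "int \<Rightarrow> real"
  assumes "a \<le> b"
  shows "(\<Sum>j\<in>{a..<b}. \<Sum>l\<in>{0..<Suc j}. g (k + 1 - int l)) - (\<Sum>j\<in>{a..<b}. \<Sum>l\<in>{0..<Suc j}. g (k - int l))
    = (real b - real a) * g (k + 1) - (\<Sum>j\<in>{a..<b}. g (k - int j))"
proof -
  have "(\<Sum>l\<in>{0..<Suc j}. g (k + 1 - int l)) - (\<Sum>l\<in>{0..<Suc j}. g (k - int l)) = g (k + 1) - g (k - int j)" for j
    using sum_lag_shift[of 0 "Suc j" g "k + 1"] by simp
  then show ?thesis
    using assms by (simp only: sum_subtractf[symmetric]) (simp add: sum_subtractf of_nat_diff)
qed

text \<open>The half-open window misses the oldest sample of the closed one when read at k, and the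
  newest when read at k - 1.\<close>

lemma lagsum_simps:
  assumes "a \<le> b"
  shows "(\<Sum>j\<in>{a..<b}. f (k - int j) i) = lagsum f k a b i - f (k - int b) i"
    and "(\<Sum>j\<in>{a..<b}. f (k - 1 - int j) i) = lagsum f k a b i - f (k - int a) i"
proof -
  show 1: "(\<Sum>j\<in>{a..<b}. f (k - int j) i) = lagsum f k a b i - f (k - int b) i"
    using assms by (simp add: lagsum_def sum.last_plus)
  show "(\<Sum>j\<in>{a..<b}. f (k - 1 - int j) i) = lagsum f k a b i - f (k - int a) i"
    using sum_lag_shift[OF assms, of "\<lambda>k. f k i" k] 1 by simp
qed

text \<open>The sample at lag \<open>d\<close> lies in both closed windows and is counted
  twice.\<close>

lemma lagsum_split:
  assumes "a \<le> d" "d \<le> b"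
  shows "lagsum f k a b i = lagsum f k a d i + lagsum f k d b i - f (k - int d) i"
proof -
  have "lagsum f k a b i = (\<Sum>j\<in>{a..<d}. f (k - int j) i) + lagsum f k d b i"
    unfolding lagsum_def using assms
    by (subst sum.union_disjoint[symmetric]) (auto intro!: sum.cong)
  then show ?thesis using lagsum_simps(1)[OF assms(1), of f k i] by simp
qed

lemma lagsum_lagmean: "a \<le> b \<Longrightarrow> lagsum f k a b i = (real b - real a + 1) * lagmean f k a b i"
  by (simp add: lagmean_def)

text \<open>The windows hold the samples at times k - d_m to k - 1 and k - d_M to k - d_m - 1. The
  unknown delay does not occur.\<close>

definition eta :: "nat \<Rightarrow> nat \<Rightarrow> nat \<Rightarrow> (int \<Rightarrow> nat \<Rightarrow> real) \<Rightarrow> int \<Rightarrow> real vec" where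
  "eta n dm dM f k = vec n (f k) @\<^sub>v (vec n (\<lambda>i. \<Sum>j\<in>{0..<dm}. f (k - 1 - int j) i) @\<^sub>v
     vec n (\<lambda>i. \<Sum>j\<in>{dm..<dM}. f (k - 1 - int j) i))"

text \<open>The sums over \<open>l\<close> run up to the lag \<open>j\<close>, so that each of them telescopes when \<open>k\<close> advances.\<close>

definition lyap :: "nat \<Rightarrow> nat \<Rightarrow> nat \<Rightarrow> real mat \<Rightarrow> real mat \<Rightarrow> real mat \<Rightarrow> real mat \<Rightarrow> real mat
    \<Rightarrow> (int \<Rightarrow> nat \<Rightarrow> real) \<Rightarrow> int \<Rightarrow> real" where
  "lyap n dm dM P W1 W2 Z1 Z2 f k = qform P (eta n dm dM f k)
     + (\<Sum>j\<in>{0..<dm}. qform W1 (vec n (f (k - 1 - int j))))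
     + (\<Sum>j\<in>{dm..<dM}. qform W2 (vec n (f (k - 1 - int j))))
     + real dm * (\<Sum>j\<in>{0..<dm}. \<Sum>l\<in>{0..<Suc j}. qform Z1 (vec n (incr f (k - int l))))
     + (real dM - real dm) * (\<Sum>j\<in>{dm..<dM}. \<Sum>l\<in>{0..<Suc j}. qform Z2 (vec n (incr f (k - int l))))"

definition aug_state :: "nat \<Rightarrow> nat \<Rightarrow> (int \<Rightarrow> nat \<Rightarrow> real) \<Rightarrow> int \<Rightarrow> nat \<Rightarrow> nat \<Rightarrow> nat \<Rightarrow> real" where
  "aug_state dm dM f k d j = [f (k + 1), f k, f (k - int dm), f (k - int d), f (k - int dM),
     lagmean f k 0 dm, lagmean f k dm d, lagmean f k d dM] ! j"

lemma aug_state_simps[simp]: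
  "aug_state dm dM f k d 0 = f (k + 1)" "aug_state dm dM f k d (Suc 0) = f k" "aug_state dm dM f k d 2 = f (k - int dm)"
  "aug_state dm dM f k d 3 = f (k - int d)" "aug_state dm dM f k d 4 = f (k - int dM)"
  "aug_state dm dM f k d 5 = lagmean f k 0 dm" "aug_state dm dM f k d 6 = lagmean f k dm d"
  "aug_state dm dM f k d 7 = lagmean f k d dM"
  by (simp_all add: aug_state_def)

text \<open>The window is split at the present delay only to express it by means: the weights d -
  d_m + 1 and d_M - d + 1 separate into the constant coefficients of \<open>F_1\<close> and the
  multiple of \<open>d\<close> in \<open>F_d\<close>.\<close>

lemma eta_current:
  assumes "dm \<le> d" "d \<le> dM"
  shows "eta n dm dM f k = F_1 n dm dM *\<^sub>v stack8 n (aug_state dm dM f k d) + F_d n (real d) *\<^sub>v stack8 n (aug_state dm dM f k d)"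
  using assms lagsum_split[OF assms, of f k]
  by (simp add: F_1_mult_vec F_d_mult_vec append_vec_plus eta_def lagsum_simps(2) lagsum_lagmean)
    (simp add: algebra_simps)

text \<open>The split is at the same \<open>d\<close> as for time k, so the two states share the
  shift by \<open>F_d\<close> that \<open>qform_increment\<close> needs. Arbitrary variation of the
  delay is therefore harmless.\<close>

lemma eta_next:
  assumes "dm \<le> d" "d \<le> dM"
  shows "eta n dm dM f (k + 1) = F_2 n dm dM *\<^sub>v stack8 n (aug_state dm dM f k d) + F_d n (real d) *\<^sub>v stack8 n (aug_state dm dM f k d)"
  using assms lagsum_split[OF assms, of f k]
  by (simp add: F_2_mult_vec F_d_mult_vec append_vec_plus eta_def lagsum_simps(1) lagsum_lagmean)
    (simp add: algebra_simps)

text \<open>Wirtinger bounds the form of each window by its length times its energy; positive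
  definiteness of \<open>Psi_z\<close> on rescaled window vectors supplies the hypothesis of the
  reciprocally convex bound.\<close>

lemma qform_Psi_z_le:
  assumes Z2: "posdef n Z2" and X: "X \<in> carrier_mat (2*n) (2*n)" and Psi: "posdef (4*n) (Psi_z Z2 X)"
    and d: "dm \<le> d" "d \<le> dM"
  shows "qform (Psi_z Z2 X) (F_Psi n *\<^sub>v stack8 n (aug_state dm dM f k d))
    \<le> (real dM - real dm) * (\<Sum>j\<in>{dm..<dM}. qform Z2 (vec n (incr f (k - int j))))"
proof -
  note Zc = posdef_carrier[OF Z2]
  define gap where "gap a b = vec n (\<lambda>i. f (k - int a) i - f (k - int b) i) @\<^sub>v
    vec n (\<lambda>i. f (k - int a) i + f (k - int b) i - 2 * lagmean f k a b i)" for a b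
  define E where "E a b = (\<Sum>j\<in>{a..<b}. qform Z2 (vec n (incr f (k - int j))))" for a b
  have gc: "gap a b \<in> carrier_vec (2*n)" for a b by (rule carrier_vecI) (simp add: gap_def)
  have E0: "0 \<le> E a b" for a b
    unfolding E_def by (intro sum_nonneg posdef_qform_nonneg[OF Z2]) simp
  have le: "qform (Zs2 Z2) (gap a b) \<le> (real b - real a) * E a b" if "a \<le> b" for a b
  proof (cases "a = b")
    \<comment> \<open>On a one-sample window the mean is the sample itself, so the gap vector is
      zero.\<close>
    case True
    have "qform Z2 (vec n (\<lambda>_. 0)) = 0" by (simp add: qform_vec[OF Zc])
    then show ?thesis using True
      by (simp add: gap_def qform_Zs2[OF Zc] lagmean_def lagsum_def)
  next
    case False
    then have ab: "a < b" using that by simp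
    have "3 * 1 * qform Z2 (vec n (\<lambda>i. f (k - int a) i + f (k - int b) i - 2 * lagmean f k a b i))
      \<le> 3 * gamma (b - a) * qform Z2 (vec n (\<lambda>i. f (k - int a) i + f (k - int b) i - 2 * lagmean f k a b i))"
      using gamma_ge_1[of "b - a"] ab posdef_qform_nonneg[OF Z2] by (intro mult_right_mono) auto
    with wirtinger_lag[OF Z2 ab, of f k] show ?thesis
      by (simp add: gap_def qform_Zs2[OF Zc] E_def)
  qed
  have "qform (Zs2 Z2) (gap dm d) + qform (Zs2 Z2) (gap d dM) + 2 * (gap d dM \<bullet> (X *\<^sub>v gap dm d))
     \<le> (real dM - real dm) * (E dm d + E d dM)"
  \<comment> \<open>The weights are the two window lengths; their sum does not depend on
    \<open>d\<close>.\<close>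
  proof (rule reciprocally_convex[where ?h1.0 = "real d - real dm" and ?h2.0 = "real dM - real d"])
    fix s t :: real
    have c: "t \<cdot>\<^sub>v gap d dM \<in> carrier_vec (2*n)" "s \<cdot>\<^sub>v gap dm d \<in> carrier_vec (2*n)"
      using gc by auto
    have "0 \<le> qform (Psi_z Z2 X) (t \<cdot>\<^sub>v gap d dM @\<^sub>v s \<cdot>\<^sub>v gap dm d)"
      using gc[THEN carrier_vecD] by (intro posdef_qform_nonneg[OF Psi] carrier_vecI) simp
    also have "\<dots> = t\<^sup>2 * qform (Zs2 Z2) (gap d dM) + s\<^sup>2 * qform (Zs2 Z2) (gap dm d)
        + 2 * (t * (s * (gap d dM \<bullet> (X *\<^sub>v gap dm d))))"
    proof -
      have "Zs2 Z2 \<in> carrier_mat (2*n) (2*n)"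
        using Zc by (intro carrier_matI) (simp_all add: Zs2_def bdiag_dim bdiag_single)
      then show ?thesis
        using qform_Psi_z[OF Zc X c] gc X
        by (simp add: qform_smult[of _ "2*n"] mult_mat_vec[of _ "2*n" "2*n"])
    qed
    finally show "0 \<le> s\<^sup>2 * qform (Zs2 Z2) (gap dm d) + t\<^sup>2 * qform (Zs2 Z2) (gap d dM)
        + 2 * s * t * (gap d dM \<bullet> (X *\<^sub>v gap dm d))"
      by (simp add: mult_ac add_ac)
  qed (use d E0 le[of dm d] le[of d dM] in auto)
  moreover have "E dm d + E d dM = E dm dM"
    unfolding E_def using d by (intro sum.atLeastLessThan_concat) auto
  moreover have "F_Psi n *\<^sub>v stack8 n (aug_state dm dM f k d) = gap d dM @\<^sub>v gap dm d"
    by (simp add: F_Psi_mult_vec gap_def)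
  ultimately show ?thesis
    using qform_Psi_z[OF Zc X gc gc] by (simp add: E_def)
qed

text \<open>Every summand of the functional has an exact increment. Inequalities enter only for the
  sums of squared increments: Wirtinger on [0, d_m] and \<open>qform_Psi_z_le\<close> on
  [d_m, d_M].\<close>

lemma lyap_step:
  assumes P: "posdef (3*n) P" and W1: "posdef n W1" and W2: "posdef n W2"
    and Z1: "posdef n Z1" and Z2: "posdef n Z2"
    and X: "X \<in> carrier_mat (2*n) (2*n)" and Psi: "posdef (4*n) (Psi_z Z2 X)"
    and d: "1 \<le> dm" "dm \<le> d" "d \<le> dM"
  shows "lyap n dm dM P W1 W2 Z1 Z2 f (k + 1) - lyap n dm dM P W1 W2 Z1 Z2 f k
    \<le> qform (Phi n dm dM P W1 W2 Z1 Z2 X (real d)) (stack8 n (aug_state dm dM f k d))"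
proof -
  let ?v = "stack8 n (aug_state dm dM f k d)"
  let ?w1 = "\<lambda>k. qform Z1 (vec n (incr f k))" let ?w2 = "\<lambda>k. qform Z2 (vec n (incr f k))"
  let ?D = "real dM - real dm"
  have eta: "qform P (eta n dm dM f (k + 1)) - qform P (eta n dm dM f k)
     = qform P (F_2 n dm dM *\<^sub>v ?v) - qform P (F_1 n dm dM *\<^sub>v ?v)
     + 2 * ((F_d n (real d) *\<^sub>v ?v) \<bullet> (P *\<^sub>v (F_2 n dm dM *\<^sub>v ?v - F_1 n dm dM *\<^sub>v ?v)))"
    unfolding eta_current[OF d(2,3), where k = k] eta_next[OF d(2,3)]
    by (intro qform_increment[OF posdef_carrier[OF P] posdef_transpose[OF P]]
        mult_mat_vec_carrier[OF _ stack8_carrier] matrix_carriers)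
  have s1: "(\<Sum>j\<in>{0..<dm}. qform W1 (vec n (f (k + 1 - 1 - int j)))) - (\<Sum>j\<in>{0..<dm}. qform W1 (vec n (f (k - 1 - int j))))
     = qform W1 (vec n (f k)) - qform W1 (vec n (f (k - int dm)))"
    using sum_lag_shift[of 0 dm "\<lambda>k. qform W1 (vec n (f k))" k] by simp
  have s2: "(\<Sum>j\<in>{dm..<dM}. qform W2 (vec n (f (k + 1 - 1 - int j)))) - (\<Sum>j\<in>{dm..<dM}. qform W2 (vec n (f (k - 1 - int j))))
     = qform W2 (vec n (f (k - int dm))) - qform W2 (vec n (f (k - int dM)))"
    using sum_lag_shift[of dm dM "\<lambda>k. qform W2 (vec n (f k))" k] d by simp
  \<comment> \<open>The outer factor in the functional is again the window length, which yields the
    squares of d_m and d_M - d_m in \<open>Phi\<close>.\<close>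
  have scale: "D * x - D * y = D\<^sup>2 * w - D * z" if "x - y = D * w - z" for D x y w z :: real
    using arg_cong[OF that, of "\<lambda>t. D * t"]
    by (simp add: right_diff_distrib power2_eq_square mult.assoc)
  have s3: "real dm * (\<Sum>j\<in>{0..<dm}. \<Sum>l\<in>{0..<Suc j}. ?w1 (k + 1 - int l))
     - real dm * (\<Sum>j\<in>{0..<dm}. \<Sum>l\<in>{0..<Suc j}. ?w1 (k - int l))
     = (real dm)\<^sup>2 * ?w1 (k + 1) - real dm * (\<Sum>j\<in>{0..<dm}. ?w1 (k - int j))"
    using double_sum_lag_shift[of 0 dm ?w1 k] by (intro scale) simp
  have s4: "?D * (\<Sum>j\<in>{dm..<dM}. \<Sum>l\<in>{0..<Suc j}. ?w2 (k + 1 - int l))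
     - ?D * (\<Sum>j\<in>{dm..<dM}. \<Sum>l\<in>{0..<Suc j}. ?w2 (k - int l))
     = ?D\<^sup>2 * ?w2 (k + 1) - ?D * (\<Sum>j\<in>{dm..<dM}. ?w2 (k - int j))"
    using d by (intro scale double_sum_lag_shift) simp
  \<comment> \<open>This window has the known length d_m, so the sharper factor
    \<open>gamma dm\<close> is kept.\<close>
  have w: "qform Z1 (vec n (\<lambda>i. f k i - f (k - int dm) i))
      + 3 * gamma dm * qform Z1 (vec n (\<lambda>i. f k i + f (k - int dm) i - 2 * lagmean f k 0 dm i))
    \<le> real dm * (\<Sum>j\<in>{0..<dm}. ?w1 (k - int j))"
    using wirtinger_lag[OF Z1, of 0 dm f k] d by simp
  have i: "vec n (\<lambda>i. f (k + 1) i - f k i) = vec n (incr f (k + 1))" by (auto simp: incr_def)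
  show ?thesis
    unfolding qform_Phi[OF posdef_carrier[OF P] posdef_carrier[OF W1] posdef_carrier[OF W2]
        posdef_carrier[OF Z1] posdef_carrier[OF Z2] X]
    using eta s1 s2 s3 s4 w qform_Psi_z_le[OF Z2 X Psi d(2,3), of f k]
    by (simp add: lyap_def i del: sum.op_ivl_Suc)
qed

section \<open>Asymptotic stability\<close>

definition entry_sum :: "real mat \<Rightarrow> real" where
  "entry_sum M = (\<Sum>i<dim_row M. \<Sum>j<dim_col M. \<bar>M $$ (i,j)\<bar>)"

lemma entry_sum_nonneg: "0 \<le> entry_sum M"
  by (simp add: entry_sum_def sum_nonneg)

lemma qform_le_entry_sum:
  assumes M: "M \<in> carrier_mat k k" and v: "v \<in> carrier_vec k" and r: "\<And>i. i < k \<Longrightarrow> \<bar>v $ i\<bar> \<le> r"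
  shows "qform M v \<le> entry_sum M * r\<^sup>2"
proof -
  have "v = vec k (\<lambda>i. v $ i)" using v by auto
  then have "qform M v = (\<Sum>i<k. \<Sum>j<k. M $$ (i,j) * (v $ i * v $ j))"
    using qform_vec[OF M, of "\<lambda>i. v $ i"] by simp
  also have "\<dots> \<le> (\<Sum>i<k. \<Sum>j<k. \<bar>M $$ (i,j)\<bar> * r\<^sup>2)"
  proof (intro sum_mono)
    fix i j assume "i \<in> {..<k}" "j \<in> {..<k}"
    then have ij: "\<bar>v $ i\<bar> \<le> r" "\<bar>v $ j\<bar> \<le> r" using r by auto
    have "M $$ (i,j) * (v $ i * v $ j) \<le> \<bar>M $$ (i,j) * (v $ i * v $ j)\<bar>" by simp
    also have "\<dots> = \<bar>M $$ (i,j)\<bar> * (\<bar>v $ i\<bar> * \<bar>v $ j\<bar>)" by (simp add: abs_mult)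
    also have "\<dots> \<le> \<bar>M $$ (i,j)\<bar> * (r * r)"
      using ij by (intro mult_left_mono mult_mono) (auto intro: order_trans[OF abs_ge_zero])
    finally show "M $$ (i,j) * (v $ i * v $ j) \<le> \<bar>M $$ (i,j)\<bar> * r\<^sup>2"
      by (simp add: power2_eq_square)
  qed
  also have "\<dots> = entry_sum M * r\<^sup>2" using M by (simp add: entry_sum_def sum_distrib_right)
  finally show ?thesis .
qed

lemma qform_vec_le_entry_sum:
  "M \<in> carrier_mat n n \<Longrightarrow> (\<And>i. i < n \<Longrightarrow> \<bar>g i\<bar> \<le> r) \<Longrightarrow> qform M (vec n g) \<le> entry_sum M * r\<^sup>2"
  by (rule qform_le_entry_sum) auto

lemma eta_carrier: "eta n dm dM f k \<in> carrier_vec (3*n)"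
  by (rule carrier_vecI) (simp add: eta_def)

text \<open>The factor covers a single sample as well as a sum of at most d_M samples.\<close>

lemma eta_entry_le:
  assumes r: "\<And>j i. j \<le> dM \<Longrightarrow> i < n \<Longrightarrow> \<bar>f (- int j) i\<bar> \<le> r" and d: "dm \<le> dM" and r0: "0 \<le> r"
    and i: "i < 3*n"
  shows "\<bar>eta n dm dM f 0 $ i\<bar> \<le> (real dM + 1) * r"
proof -
  have s: "\<bar>\<Sum>j\<in>{a..<b}. f (- 1 - int j) l\<bar> \<le> (real dM + 1) * r" if "b \<le> dM" "l < n" for a b l
  proof -
    have "\<bar>\<Sum>j\<in>{a..<b}. f (- 1 - int j) l\<bar> \<le> (\<Sum>j\<in>{a..<b}. \<bar>f (- 1 - int j) l\<bar>)" by (rule sum_abs)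
    also have "\<dots> \<le> (\<Sum>j\<in>{a..<b}. r)"
    proof (rule sum_mono)
      fix j assume "j \<in> {a..<b}"
      then have "Suc j \<le> dM" using that by auto
      from r[OF this that(2)] show "\<bar>f (- 1 - int j) l\<bar> \<le> r" by (simp add: algebra_simps)
    qed
    also have "\<dots> = real (b - a) * r" by simp
    also have "\<dots> \<le> (real dM + 1) * r" using that r0 by (intro mult_right_mono) auto
    finally show ?thesis .
  qed
  have "\<bar>f 0 l\<bar> \<le> (real dM + 1) * r" if "l < n" for l
    using r[of 0 l] that r0 mult_right_mono[of 1 "real dM + 1" r] by simp
  then show ?thesis using i d s by (auto simp: eta_def)
qed

text \<open>At time 0 the functional involves only the samples at times -d_M to 0, so it is bounded
  quadratically by the size of the initial data.\<close>

lemma lyap_initial_bound: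
  assumes P: "P \<in> carrier_mat (3*n) (3*n)" and W1: "W1 \<in> carrier_mat n n" and W2: "W2 \<in> carrier_mat n n"
    and Z1: "Z1 \<in> carrier_mat n n" and Z2: "Z2 \<in> carrier_mat n n" and d: "dm \<le> dM"
  obtains c where "c \<ge> 0"
    "\<And>f r. 0 \<le> r \<Longrightarrow> (\<And>j i. j \<le> dM \<Longrightarrow> i < n \<Longrightarrow> \<bar>f (- int j) i\<bar> \<le> r)
      \<Longrightarrow> lyap n dm dM P W1 W2 Z1 Z2 f 0 \<le> c * r\<^sup>2"
proof -
  \<comment> \<open>The factors are squares of amplitude bounds: (d_M + 1) r for the entries of
    \<open>eta\<close> and 2 r for increments.\<close>
  define c where "c = entry_sum P * (real dM + 1)\<^sup>2 + (\<Sum>j\<in>{0..<dm}. entry_sum W1)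
     + (\<Sum>j\<in>{dm..<dM}. entry_sum W2)
     + real dm * (\<Sum>j\<in>{0..<dm}. \<Sum>l\<in>{0..<Suc j}. entry_sum Z1 * 4)
     + (real dM - real dm) * (\<Sum>j\<in>{dm..<dM}. \<Sum>l\<in>{0..<Suc j}. entry_sum Z2 * 4)"
  show thesis
  proof (rule that[of c])
    show "c \<ge> 0" unfolding c_def using d
      by (intro add_nonneg_nonneg mult_nonneg_nonneg sum_nonneg entry_sum_nonneg) auto
    fix f :: "int \<Rightarrow> nat \<Rightarrow> real" and r :: real
    assume r0: "0 \<le> r" and r: "\<And>j i. j \<le> dM \<Longrightarrow> i < n \<Longrightarrow> \<bar>f (- int j) i\<bar> \<le> r"
    have x: "\<bar>f (0 - 1 - int j) i\<bar> \<le> r" if "j < dM" "i < n" for i j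
      using r[of "Suc j" i] that by (simp add: algebra_simps)
    \<comment> \<open>An increment at lag \<open>l\<close> reaches back to lag l + 1; the strict
      bound on \<open>l\<close> keeps it inside the initial data.\<close>
    have in2: "\<bar>incr f (0 - int l) i\<bar> \<le> 2 * r" if "l < dM" "i < n" for i l
    proof -
      have e: "0 - int l - 1 = 0 - 1 - int l" by simp
      show ?thesis using r[of l i] x[of l i] that unfolding incr_def e by simp
    qed
    have 1: "qform P (eta n dm dM f 0) \<le> entry_sum P * ((real dM + 1) * r)\<^sup>2"
      by (rule qform_le_entry_sum[OF P eta_carrier]) (rule eta_entry_le[where f = f], use r d r0 in auto)
    have 2: "(\<Sum>j\<in>{0..<dm}. qform W1 (vec n (f (0 - 1 - int j)))) \<le> (\<Sum>j\<in>{0..<dm}. entry_sum W1 * r\<^sup>2)"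
      using d by (intro sum_mono qform_vec_le_entry_sum[OF W1] x) auto
    have 3: "(\<Sum>j\<in>{dm..<dM}. qform W2 (vec n (f (0 - 1 - int j)))) \<le> (\<Sum>j\<in>{dm..<dM}. entry_sum W2 * r\<^sup>2)"
      using d by (intro sum_mono qform_vec_le_entry_sum[OF W2] x) auto
    have 4: "real dm * (\<Sum>j\<in>{0..<dm}. \<Sum>l\<in>{0..<Suc j}. qform Z1 (vec n (incr f (0 - int l))))
        \<le> real dm * (\<Sum>j\<in>{0..<dm}. \<Sum>l\<in>{0..<Suc j}. entry_sum Z1 * (2 * r)\<^sup>2)"
      using d by (intro mult_left_mono sum_mono qform_vec_le_entry_sum[OF Z1] in2) auto
    have 5: "(real dM - real dm) * (\<Sum>j\<in>{dm..<dM}. \<Sum>l\<in>{0..<Suc j}. qform Z2 (vec n (incr f (0 - int l))))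
        \<le> (real dM - real dm) * (\<Sum>j\<in>{dm..<dM}. \<Sum>l\<in>{0..<Suc j}. entry_sum Z2 * (2 * r)\<^sup>2)"
      using d by (intro mult_left_mono sum_mono qform_vec_le_entry_sum[OF Z2] in2) auto
    have "c * r\<^sup>2 = entry_sum P * ((real dM + 1) * r)\<^sup>2 + (\<Sum>j\<in>{0..<dm}. entry_sum W1 * r\<^sup>2)
      + (\<Sum>j\<in>{dm..<dM}. entry_sum W2 * r\<^sup>2)
      + real dm * (\<Sum>j\<in>{0..<dm}. \<Sum>l\<in>{0..<Suc j}. entry_sum Z1 * (2 * r)\<^sup>2)
      + (real dM - real dm) * (\<Sum>j\<in>{dm..<dM}. \<Sum>l\<in>{0..<Suc j}. entry_sum Z2 * (2 * r)\<^sup>2)"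
      unfolding c_def power_mult_distrib
      by (simp only: distrib_right sum_distrib_right mult.assoc power2_eq_square) simp
    with 1 2 3 4 5 show "lyap n dm dM P W1 W2 Z1 Z2 f 0 \<le> c * r\<^sup>2"
      unfolding lyap_def by linarith
  qed
qed

text \<open>The current state is the first block of \<open>eta\<close>, so coercivity of
  \<open>P\<close> suffices; all other summands are nonnegative.\<close>

lemma lyap_coercive:
  assumes P: "posdef (3*n) P" and W1: "posdef n W1" and W2: "posdef n W2"
    and Z1: "posdef n Z1" and Z2: "posdef n Z2" and d: "dm \<le> dM"
  obtains c where "c > 0" "\<And>f k. c * (\<Sum>i<n. (f k i)\<^sup>2) \<le> lyap n dm dM P W1 W2 Z1 Z2 f k"
proof -
  obtain c where c: "c > 0" and co: "\<And>v. v \<in> carrier_vec (3*n) \<Longrightarrow> c * (v \<bullet> v) \<le> qform P v"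
    using posdef_coercive[OF P] by blast
  show thesis
  proof (rule that[OF c])
    fix f :: "int \<Rightarrow> nat \<Rightarrow> real" and k
    let ?t = "vec n (\<lambda>i. \<Sum>j\<in>{0..<dm}. f (k - 1 - int j) i) @\<^sub>v
      vec n (\<lambda>i. \<Sum>j\<in>{dm..<dM}. f (k - 1 - int j) i)"
    have "eta n dm dM f k \<bullet> eta n dm dM f k = vec n (f k) \<bullet> vec n (f k) + ?t \<bullet> ?t"
      unfolding eta_def by (rule scalar_prod_append[of _ n _ "n + n"]) auto
    moreover have "0 \<le> ?t \<bullet> ?t" unfolding scalar_prod_def by (intro sum_nonneg) simp
    ultimately have "(\<Sum>i<n. (f k i)\<^sup>2) \<le> eta n dm dM f k \<bullet> eta n dm dM f k"
      by (simp add: sum_squares_vec)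
    then have "c * (\<Sum>i<n. (f k i)\<^sup>2) \<le> c * (eta n dm dM f k \<bullet> eta n dm dM f k)" using c by simp
    also have "\<dots> \<le> qform P (eta n dm dM f k)" by (rule co[OF eta_carrier])
    also have "\<dots> \<le> lyap n dm dM P W1 W2 Z1 Z2 f k"
    proof -
      have "0 \<le> (\<Sum>j\<in>{0..<dm}. qform W1 (vec n (f (k - 1 - int j))))"
        "0 \<le> (\<Sum>j\<in>{dm..<dM}. qform W2 (vec n (f (k - 1 - int j))))"
        "0 \<le> real dm * (\<Sum>j\<in>{0..<dm}. \<Sum>l\<in>{0..<Suc j}. qform Z1 (vec n (incr f (k - int l))))"
        "0 \<le> (real dM - real dm) * (\<Sum>j\<in>{dm..<dM}. \<Sum>l\<in>{0..<Suc j}. qform Z2 (vec n (incr f (k - int l))))"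
        using d by (intro mult_nonneg_nonneg sum_nonneg posdef_qform_nonneg[OF W1]
            posdef_qform_nonneg[OF W2] posdef_qform_nonneg[OF Z1] posdef_qform_nonneg[OF Z2]; simp)+
      then show ?thesis unfolding lyap_def by linarith
    qed
    finally show "c * (\<Sum>i<n. (f k i)\<^sup>2) \<le> lyap n dm dM P W1 W2 Z1 Z2 f k" .
  qed
qed

text \<open>Summing the step inequality bounds all partial sums of \<open>N\<close> by V(0) / e;
  convergence follows from summability, without any rate for \<open>V\<close>.\<close>

lemma lyapunov_decay:
  fixes V N :: "nat \<Rightarrow> real"
  assumes e: "e > 0" and N: "\<And>k. 0 \<le> N k" and V: "\<And>k. 0 \<le> V k"
    and step: "\<And>k. V (Suc k) \<le> V k - e * N k"
  shows "V k \<le> V 0" "N \<longlonglongrightarrow> 0"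
proof -
  have b: "V k + e * (\<Sum>j<k. N j) \<le> V 0" for k
  proof (induction k)
    case (Suc k)
    then show ?case using step[of k] by (simp add: distrib_left)
  qed simp
  show "V k \<le> V 0" using b[of k] e N by (smt (verit) mult_nonneg_nonneg sum_nonneg)
  have "summable N"
  proof (rule summableI_nonneg_bounded[OF N])
    fix k
    have "e * (\<Sum>j<k. N j) \<le> V 0" using b[of k] V[of k] by linarith
    then show "(\<Sum>j<k. N j) \<le> V 0 / e" using e by (simp add: field_simps)
  qed
  then show "N \<longlonglongrightarrow> 0" by (rule summable_LIMSEQ_zero)
qed

lemma vnorm_vec: "(vnorm (vec n f))\<^sup>2 = (\<Sum>i<n. (f i)\<^sup>2)"
  by (simp add: vnorm_def sum_nonneg)

lemma abs_index_le_vnorm: "i < dim_vec v \<Longrightarrow> \<bar>v $ i\<bar> \<le> vnorm v"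
  unfolding vnorm_def by (intro real_le_rsqrt) (auto intro: member_le_sum[of i _ "\<lambda>i. (v $ i)\<^sup>2"])

lemma vnorm_nonneg: "0 \<le> vnorm v"
  by (simp add: vnorm_def sum_nonneg)

lemma closed_loop_solution_carrier:
  assumes sol: "closed_loop_solution n A Ad dM d phi x" and phi: "\<And>k. phi k \<in> carrier_vec n"
    and Ad: "Ad \<in> carrier_mat n q" and k: "- int dM \<le> k"
  shows "x k \<in> carrier_vec n"
proof (cases "k \<le> 0")
  case True
  then show ?thesis using sol phi k by (simp add: closed_loop_solution_def)
next
  case False
  then have "k = int (nat (k - 1)) + 1" by simp
  then have "x k = A *\<^sub>v x (int (nat (k - 1))) + Ad *\<^sub>v x (int (nat (k - 1)) - int (d (nat (k - 1))))"
    using sol unfolding closed_loop_solution_def by metis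
  \<comment> \<open>A vector sum takes its dimension from the second summand, so no induction over
    time is needed.\<close>
  then show ?thesis using Ad by (intro carrier_vecI) simp
qed

text \<open>The gain makes the input satisfy R u = - S^T y with the delayed output, so both vertex
  estimates apply; the smaller rate holds at both ends, and affinity in the delay carries it to
  every \<open>d\<close> between.\<close>

lemma closed_loop_dissipation:
  fixes A B C P W1 W2 Z1 Z2 R Q S X :: "real mat"
  assumes A: "A \<in> carrier_mat n n" and B: "B \<in> carrier_mat n m" and C: "C \<in> carrier_mat p n"
    and delay: "1 \<le> dm" "dm \<le> dM"
    and P: "posdef (3*n) P"
    and W1: "posdef n W1" and W2: "posdef n W2" and Z1: "posdef n Z1" and Z2: "posdef n Z2"
    and R: "posdef m R" and Q: "sym_mat p Q" and S: "S \<in> carrier_mat p m"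
    and X: "X \<in> carrier_mat (2*n) (2*n)"
    and LMI_Psi: "posdef (4*n) (Psi_z Z2 X)"
    and LMI_main: "\<forall>d \<in> {real dm, real dM}.
       negdef (7*n + m) ((Gamma_perp n m A B)\<^sup>T
          * (Phi_bar n m dm dM P W1 W2 Z1 Z2 X d + Upsilon n m C Q R S) * Gamma_perp n m A B)"
    and LMI_3: "negdef (p + m) (LMI3 p m \<rho> Q R S)"
  obtains e where "e > 0"
    "\<And>f k d. dm \<le> d \<Longrightarrow> d \<le> dM \<Longrightarrow>
      vec n (f (k + 1)) = A *\<^sub>v vec n (f k)
        + (B * (- (the (mat_inverse R) * S\<^sup>T)) * C) *\<^sub>v vec n (f (k - int d)) \<Longrightarrow>
      lyap n dm dM P W1 W2 Z1 Z2 f (k + 1) \<le> lyap n dm dM P W1 W2 Z1 Z2 f k - e * (\<Sum>i<n. (f k i)\<^sup>2)"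
proof -
  define R' where "R' = the (mat_inverse R)"
  have R': "R' \<in> carrier_mat m m" "R * R' = 1\<^sub>m m"
    using posdef_mat_inverse[OF R] by (auto simp: R'_def)
  note Rc = posdef_carrier[OF R]
  note c = posdef_carrier[OF P] posdef_carrier[OF W1] posdef_carrier[OF W2]
    posdef_carrier[OF Z1] posdef_carrier[OF Z2] X
  have Qc: "Q \<in> carrier_mat p p" using Q by (simp add: sym_mat_def)
  note vertex = qform_Phi_negative_at_vertex[OF A B C c R Qc S _ LMI_3]
  obtain e1 where e1: "e1 > 0" and v1: "\<And>x u. u \<in> carrier_vec m \<Longrightarrow> vec n (x 0) = A *\<^sub>v vec n (x 1) + B *\<^sub>v u \<Longrightarrow>
     R *\<^sub>v u = - (S\<^sup>T *\<^sub>v (C *\<^sub>v vec n (x 3))) \<Longrightarrow>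
     qform (Phi n dm dM P W1 W2 Z1 Z2 X (real dm)) (stack8 n x) \<le> - e1 * (\<Sum>i<n. (x 1 i)\<^sup>2)"
    using vertex[of dm dM "real dm"] LMI_main by blast
  obtain e2 where e2: "e2 > 0" and v2: "\<And>x u. u \<in> carrier_vec m \<Longrightarrow> vec n (x 0) = A *\<^sub>v vec n (x 1) + B *\<^sub>v u \<Longrightarrow>
     R *\<^sub>v u = - (S\<^sup>T *\<^sub>v (C *\<^sub>v vec n (x 3))) \<Longrightarrow>
     qform (Phi n dm dM P W1 W2 Z1 Z2 X (real dM)) (stack8 n x) \<le> - e2 * (\<Sum>i<n. (x 1 i)\<^sup>2)"
    using vertex[of dm dM "real dM"] LMI_main by blast
  define e where "e = min e1 e2"
  show thesis
  proof (rule that[of e])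
    show "e > 0" using e1 e2 by (simp add: e_def)
    fix f :: "int \<Rightarrow> nat \<Rightarrow> real" and k d
    assume d: "dm \<le> d" "d \<le> dM"
      and x: "vec n (f (k + 1)) = A *\<^sub>v vec n (f k)
        + (B * (- (the (mat_inverse R) * S\<^sup>T)) * C) *\<^sub>v vec n (f (k - int d))"
    let ?x = "aug_state dm dM f k d" and ?N = "\<Sum>i<n. (f k i)\<^sup>2"
    define y where "y = C *\<^sub>v vec n (f (k - int d))"
    define u where "u = - (R' *\<^sub>v (S\<^sup>T *\<^sub>v y))"
    have y: "y \<in> carrier_vec p" using C by (simp add: y_def)
    have Sy: "S\<^sup>T *\<^sub>v y \<in> carrier_vec m" using S y by simp
    have u: "u \<in> carrier_vec m" using R' Sy by (simp add: u_def)
    have K: "(- (R' * S\<^sup>T)) *\<^sub>v y = u"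
      using R' S y by (simp add: u_def)
    have "(B * (- (R' * S\<^sup>T)) * C) *\<^sub>v vec n (f (k - int d)) = (B * (- (R' * S\<^sup>T))) *\<^sub>v y"
      unfolding y_def using B R' S C by (intro assoc_mult_mat_vec) auto
    also have "\<dots> = B *\<^sub>v ((- (R' * S\<^sup>T)) *\<^sub>v y)"
      using B R' S y by (intro assoc_mult_mat_vec) auto
    finally have x0: "vec n (?x 0) = A *\<^sub>v vec n (?x 1) + B *\<^sub>v u"
      using x[folded R'_def] by (simp add: K)
    have "R *\<^sub>v u = - (R *\<^sub>v (R' *\<^sub>v (S\<^sup>T *\<^sub>v y)))"
      using Rc R' Sy unfolding u_def by (intro eq_vecI) auto
    also have "R *\<^sub>v (R' *\<^sub>v (S\<^sup>T *\<^sub>v y)) = S\<^sup>T *\<^sub>v y"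
      using assoc_mult_mat_vec[OF Rc R'(1) Sy] R'(2) Sy by simp
    finally have Ru: "R *\<^sub>v u = - (S\<^sup>T *\<^sub>v (C *\<^sub>v vec n (?x 3)))" by (simp add: y_def)
    have N: "0 \<le> ?N" by (simp add: sum_nonneg)
    have "e * ?N \<le> e1 * ?N" "e * ?N \<le> e2 * ?N" using N by (auto simp: e_def intro!: mult_right_mono)
    with v1[OF u x0 Ru] v2[OF u x0 Ru]
    have q: "qform (Phi n dm dM P W1 W2 Z1 Z2 X (real dm)) (stack8 n ?x) \<le> - (e * ?N)"
      "qform (Phi n dm dM P W1 W2 Z1 Z2 X (real dM)) (stack8 n ?x) \<le> - (e * ?N)" by auto
    obtain a b where ab: "\<And>d. qform (Phi n dm dM P W1 W2 Z1 Z2 X d) (stack8 n ?x) = a + d * b"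
      using qform_Phi_affine[OF c, of dm dM ?x] by blast
    \<comment> \<open>The sign of the slope decides which endpoint dominates.\<close>
    have "real d * b \<le> real dm * b \<or> real d * b \<le> real dM * b"
      using d by (cases "0 \<le> b") (auto intro: mult_right_mono mult_right_mono_neg)
    then have "qform (Phi n dm dM P W1 W2 Z1 Z2 X (real d)) (stack8 n ?x) \<le> - (e * ?N)"
      using q unfolding ab by auto
    with lyap_step[OF P W1 W2 Z1 Z2 X LMI_Psi delay(1) d, of f k]
    show "lyap n dm dM P W1 W2 Z1 Z2 f (k + 1) \<le> lyap n dm dM P W1 W2 Z1 Z2 f k - e * ?N"
      by linarith
  qed
qed

theorem theorem1:
  fixes n m p dm dM :: nat and \<rho> :: real
    and A B C P W1 W2 Z1 Z2 R Q S X :: "real mat"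
  assumes A: "A \<in> carrier_mat n n" and B: "B \<in> carrier_mat n m" and C: "C \<in> carrier_mat p n"
    and ctrb: "controllable n A B"
    and delay: "1 \<le> dm" "dm \<le> dM"
    and P: "posdef (3*n) P"
    and W1: "posdef n W1" and W2: "posdef n W2" and Z1: "posdef n Z1" and Z2: "posdef n Z2"
    and R: "posdef m R"
    and Q: "sym_mat p Q"
    and S: "S \<in> carrier_mat p m"
    and X: "X \<in> carrier_mat (2*n) (2*n)"
    and LMI_Psi: "posdef (4*n) (Psi_z Z2 X)"
    and LMI_main: "\<forall>d \<in> {real dm, real dM}.
       negdef (7*n + m) ((Gamma_perp n m A B)\<^sup>T
          * (Phi_bar n m dm dM P W1 W2 Z1 Z2 X d + Upsilon n m C Q R S) * Gamma_perp n m A B)"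
    and LMI_3: "negdef (p + m) (LMI3 p m \<rho> Q R S)"
  shows "asymp_stable_delay n A (B * (- (the (mat_inverse R) * S\<^sup>T)) * C) dm dM"
proof -
  define Ad where "Ad = B * (- (the (mat_inverse R) * S\<^sup>T)) * C"
  have Ad: "Ad \<in> carrier_mat n n" using B C by (auto simp: Ad_def)
  let ?V = "lyap n dm dM P W1 W2 Z1 Z2"
  obtain e where e: "e > 0" and dis: "\<And>f k d. dm \<le> d \<Longrightarrow> d \<le> dM \<Longrightarrow>
      vec n (f (k + 1)) = A *\<^sub>v vec n (f k)
        + (B * (- (the (mat_inverse R) * S\<^sup>T)) * C) *\<^sub>v vec n (f (k - int d)) \<Longrightarrow>
      ?V f (k + 1) \<le> ?V f k - e * (\<Sum>i<n. (f k i)\<^sup>2)"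
    by (rule closed_loop_dissipation[OF A B C delay P W1 W2 Z1 Z2 R Q S X LMI_Psi LMI_main LMI_3]) blast
  obtain c where c: "c > 0" and co: "\<And>f k. c * (\<Sum>i<n. (f k i)\<^sup>2) \<le> ?V f k"
    by (rule lyap_coercive[OF P W1 W2 Z1 Z2 delay(2)]) blast
  obtain b where b: "b \<ge> 0" and ini: "\<And>f r. 0 \<le> r \<Longrightarrow>
      (\<And>j i. j \<le> dM \<Longrightarrow> i < n \<Longrightarrow> \<bar>f (- int j) i\<bar> \<le> r) \<Longrightarrow> ?V f 0 \<le> b * r\<^sup>2"
    by (rule lyap_initial_bound[OF posdef_carrier[OF P] posdef_carrier[OF W1] posdef_carrier[OF W2]
          posdef_carrier[OF Z1] posdef_carrier[OF Z2] delay(2)]) blast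
  define F where "F x k i = x k $ i" for x :: "int \<Rightarrow> real vec" and k i
  have sol: "(\<forall>k. ?V (F x) (int k) \<le> ?V (F x) 0) \<and> (\<lambda>k. (vnorm (x (int k)))\<^sup>2) \<longlonglongrightarrow> 0
      \<and> (\<forall>k. c * (vnorm (x (int k)))\<^sup>2 \<le> ?V (F x) (int k))"
    if d: "\<forall>k. dm \<le> d k \<and> d k \<le> dM" and phi: "\<forall>k. phi k \<in> carrier_vec n"
      and s: "closed_loop_solution n A Ad dM d phi x" for d phi x
  proof -
    \<comment> \<open>Only from time -d_M on is x(k) known to have dimension n; the equation reads
      no earlier samples because the delay is at most d_M.\<close>
    have xk: "x k = vec n (F x k)" if "- int dM \<le> k" for k
      using closed_loop_solution_carrier[OF s _ Ad that] phi by (auto simp: F_def)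
    have nrm: "(vnorm (x (int k)))\<^sup>2 = (\<Sum>i<n. (F x (int k) i)\<^sup>2)" for k
      using xk[of "int k"] vnorm_vec[of n "F x (int k)"] by simp
    have co': "c * (vnorm (x (int k)))\<^sup>2 \<le> ?V (F x) (int k)" for k
      unfolding nrm by (rule co)
    have step: "?V (F x) (int (Suc k)) \<le> ?V (F x) (int k) - e * (vnorm (x (int k)))\<^sup>2" for k
    proof -
      have dk: "dm \<le> d k" "d k \<le> dM" using d by auto
      have "x (int k + 1) = A *\<^sub>v x (int k) + Ad *\<^sub>v x (int k - int (d k))"
        using s by (simp add: closed_loop_solution_def)
      then have "vec n (F x (int k + 1)) = A *\<^sub>v vec n (F x (int k)) + Ad *\<^sub>v vec n (F x (int k - int (d k)))"
        using xk[of "int k + 1"] xk[of "int k"] xk[of "int k - int (d k)"] dk by simp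
      from dis[folded Ad_def, OF dk this] show ?thesis by (simp add: nrm add.commute)
    qed
    have V0: "0 \<le> ?V (F x) (int k)" for k
      using co'[of k] c by (smt (verit) mult_nonneg_nonneg zero_le_power2)
    from lyapunov_decay[of e "\<lambda>k. (vnorm (x (int k)))\<^sup>2" "\<lambda>k. ?V (F x) (int k)", OF e _ V0 step] co'
    show ?thesis by simp
  qed
  have "\<exists>\<delta>>0. \<forall>phi x. (\<forall>k. phi k \<in> carrier_vec n) \<longrightarrow> closed_loop_solution n A Ad dM d phi x \<longrightarrow>
      (\<forall>k. - int dM \<le> k \<and> k \<le> 0 \<longrightarrow> vnorm (phi k) < \<delta>) \<longrightarrow> (\<forall>k::nat. vnorm (x (int k)) < \<epsilon>)"
    if d: "\<forall>k. dm \<le> d k \<and> d k \<le> dM" and eps: "\<epsilon> > 0" for d and \<epsilon> :: real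
  proof -
    \<comment> \<open>Chosen so that the initial bound b \<delta>^2 stays below the coercivity level
      c \<epsilon>^2; b + 1 keeps the quotient defined when b = 0.\<close>
    define \<delta> where "\<delta> = \<epsilon> * sqrt (c / (b + 1))"
    have \<delta>: "\<delta> > 0" using eps c b by (simp add: \<delta>_def)
    have "b * \<delta>\<^sup>2 = c * \<epsilon>\<^sup>2 * (b / (b + 1))" using c b by (simp add: \<delta>_def power_mult_distrib)
    also have "\<dots> < c * \<epsilon>\<^sup>2 * 1" using b c eps by (intro mult_strict_left_mono) (auto simp: field_simps)
    finally have small: "b * \<delta>\<^sup>2 < c * \<epsilon>\<^sup>2" by simp
    have "vnorm (x (int k)) < \<epsilon>" if phi: "\<forall>k. phi k \<in> carrier_vec n"
      and s: "closed_loop_solution n A Ad dM d phi x"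
      and le: "\<forall>k. - int dM \<le> k \<and> k \<le> 0 \<longrightarrow> vnorm (phi k) < \<delta>" for phi x k
    proof -
      have "\<bar>F x (- int j) i\<bar> \<le> \<delta>" if "j \<le> dM" "i < n" for i j
      proof -
        have "x (- int j) = phi (- int j)" using s that by (simp add: closed_loop_solution_def)
        moreover have "\<bar>phi (- int j) $ i\<bar> \<le> vnorm (phi (- int j))"
          using phi that by (intro abs_index_le_vnorm) (metis carrier_vecD)
        moreover have "vnorm (phi (- int j)) < \<delta>" using le that by simp
        ultimately show ?thesis by (simp add: F_def)
      qed
      with ini[of \<delta> "F x"] \<delta> have "?V (F x) 0 \<le> b * \<delta>\<^sup>2" by simp
      moreover have "?V (F x) (int k) \<le> ?V (F x) 0" "c * (vnorm (x (int k)))\<^sup>2 \<le> ?V (F x) (int k)"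
        using sol[OF d phi s] by auto
      ultimately have "c * (vnorm (x (int k)))\<^sup>2 < c * \<epsilon>\<^sup>2" using small by linarith
      then have "(vnorm (x (int k)))\<^sup>2 < \<epsilon>\<^sup>2" using c by simp
      then show ?thesis using eps by (auto intro: power2_less_imp_less[OF _ less_imp_le])
    qed
    with \<delta> show ?thesis by blast
  qed
  moreover have "(\<lambda>k::nat. vnorm (x (int k))) \<longlonglongrightarrow> 0"
    if d: "\<forall>k. dm \<le> d k \<and> d k \<le> dM" and phi: "\<forall>k. phi k \<in> carrier_vec n"
      and s: "closed_loop_solution n A Ad dM d phi x" for d phi x
  proof -
    have "(\<lambda>k. (vnorm (x (int k)))\<^sup>2) \<longlonglongrightarrow> 0" using sol[OF d phi s] by blast
    from tendsto_real_sqrt[OF this] show ?thesis by (simp add: vnorm_nonneg)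
  qed
  ultimately show ?thesis unfolding asymp_stable_delay_def Ad_def[symmetric] by blast
qed

end
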